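(* Let $d\geq 4$. Then there exists a PPT-map $\Phi:\mathbb{M}_d\to\mathbb{M}_d$ which is not $2$-entanglement breaking. Moreover, $\Phi$ can be chosen such that $SN(\Phi)=SN(\Phi\circ\mathsf{T})=2$.
   Context: $\mathbb{M}_d$ is the algebra of complex $d\times d$ matrices; a superscript $+$ denotes the cone of positive semidefinite matrices; $\mathsf{T}$ is the transpose map. A linear map $\Phi$ between matrix algebras is positive if it preserves positive semidefiniteness, $k$-positive if $\mathrm{id}_k\otimes\Phi$ is positive, and completely positive (CP) if it is $k$-positive for all $k\geq1$. A linear map $\Phi$ is a PPT-map if both $\Phi$ and $\mathsf{T}\circ\Phi$ (equivalently $\Phi\circ\mathsf{T}$) are CP. $X\in(\mathbb{M}_{m}\otimes\mathbb{M}_{n})^+$ is separable if $X=\sum_i A_i\otimes B_i$ (finite sum) with $A_i\in\mathbb{M}_m^+$, $B_i\in\mathbb{M}_n^+$. $\Phi:\mathbb{M}_d\to\mathbb{M}_d$ is $k$-entanglement breaking if it is $k$-positive and $(\mathrm{id}_k\otimes\Phi)(X)$ is separable for every $X\in(\mathbb{M}_k\otimes\mathbb{M}_d)^+$. The Schmidt rank $SR(\xi)$ of $\xi\in\mathbb{C}^{m}\otimes\mathbb{C}^{n}$ is the number of nonzero coefficients in a Schmidt decomposition $\xi=\sum_i\lambda_i\,u_i\otimes v_i$ ($\{u_i\}$, $\{v_i\}$ orthonormal, $\lambda_i\ge0$). The Schmidt number of $X\in(\mathbb{M}_m\otimes\mathbb{M}_n)^+$ is $SN(X)=\min\max_i SR(\xi_i)$,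 the minimum being over all finite decompositions $X=\sum_i|\xi_i\rangle\langle\xi_i|$ into rank-one positive operators $|\xi\rangle\langle\xi|(z)=\xi\langle\xi,z\rangle$. For a CP-map $\Phi:\mathbb{M}_d\to\mathbb{M}_d$, $SN(\Phi):=SN(C_\Phi)$, where $C_\Phi=\sum_{i,j}E_{ij}\otimes\Phi(E_{ij})$ is the Choi matrix; equivalently $SN(\Phi)$ is the minimum over all decompositions $\Phi(X)=\sum_i V_i^*XV_i$ of $\max_i\mathrm{rank}(V_i)$. *)

theory Defs
  imports "Jordan_Normal_Form.Matrix"
begin

text \<open>
  The algebra of complex \<open>d \<times> d\<close> matrices is \<open>carrier_mat d d\<close>. A map between such algebras is a
  function on the type \<open>complex mat\<close>, and only its values on \<open>carrier_mat d d\<close> matter.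
  Tensor products use the lexicographic index convention: the pair \<open>(i, j)\<close> with \<open>i < m\<close>, \<open>j < n\<close>
  is identified with \<open>i * n + j < m * n\<close>.
\<close>

definition mat_unit :: "nat \<Rightarrow> nat \<Rightarrow> nat \<Rightarrow> complex mat" where
  "mat_unit d i j = mat d d (\<lambda>(p, q). if p = i \<and> q = j then 1 else 0)"

definition kron :: "complex mat \<Rightarrow> complex mat \<Rightarrow> complex mat" where
  "kron A B = mat (dim_row A * dim_row B) (dim_col A * dim_col B)
     (\<lambda>(i, j). A $$ (i div dim_row B, j div dim_col B) * B $$ (i mod dim_row B, j mod dim_col B))"

definition kron_vec :: "complex vec \<Rightarrow> complex vec \<Rightarrow> complex vec" where
  "kron_vec u v = vec (dim_vec u * dim_vec v)
     (\<lambda>i. u $ (i div dim_vec v) * v $ (i mod dim_vec v))"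

text \<open>
  The order on \<open>complex\<close> is the one of \<^theory>\<open>HOL-Library.Complex_Order\<close>: \<open>0 \<le> z\<close> means that \<open>z\<close> is real
  and nonnegative. Over the complex numbers this forces the matrix to be Hermitian.
\<close>

definition psd :: "nat \<Rightarrow> complex mat set" where
  "psd n = {A \<in> carrier_mat n n. \<forall>v \<in> carrier_vec n. 0 \<le> (A *\<^sub>v v) \<bullet>c v}"

definition linear_mat_map :: "nat \<Rightarrow> (complex mat \<Rightarrow> complex mat) \<Rightarrow> bool" where
  "linear_mat_map d \<Phi> \<longleftrightarrow>
     (\<forall>A \<in> carrier_mat d d. \<Phi> A \<in> carrier_mat d d) \<and>
     (\<forall>A \<in> carrier_mat d d. \<forall>B \<in> carrier_mat d d. \<Phi> (A + B) = \<Phi> A + \<Phi> B) \<and>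
     (\<forall>c. \<forall>A \<in> carrier_mat d d. \<Phi> (c \<cdot>\<^sub>m A) = c \<cdot>\<^sub>m \<Phi> A)"

definition positive_map :: "nat \<Rightarrow> (complex mat \<Rightarrow> complex mat) \<Rightarrow> bool" where
  "positive_map d \<Phi> \<longleftrightarrow> linear_mat_map d \<Phi> \<and> (\<forall>A \<in> psd d. \<Phi> A \<in> psd d)"

definition mat_block :: "nat \<Rightarrow> complex mat \<Rightarrow> nat \<Rightarrow> nat \<Rightarrow> complex mat" where
  "mat_block d X a b = mat d d (\<lambda>(p, q). X $$ (a * d + p, b * d + q))"

text \<open>
  The map \<open>id\<^sub>k \<otimes> \<Phi>\<close>: a matrix of size \<open>k * d\<close> is \<open>\<Sum> E\<^sub>a\<^sub>b \<otimes> X\<^sub>a\<^sub>b\<close> over its \<open>d \<times> d\<close> blocks \<open>X\<^sub>a\<^sub>b\<close>,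
  and \<open>\<Phi>\<close> acts on each block.
\<close>

definition ampliation :: "nat \<Rightarrow> nat \<Rightarrow> (complex mat \<Rightarrow> complex mat) \<Rightarrow> complex mat \<Rightarrow> complex mat" where
  "ampliation k d \<Phi> X = mat (k * d) (k * d)
     (\<lambda>(i, j). \<Phi> (mat_block d X (i div d) (j div d)) $$ (i mod d, j mod d))"

lemma ampliation_kron:
  assumes "linear_mat_map d \<Phi>" "A \<in> carrier_mat k k" "B \<in> carrier_mat d d"
  shows "ampliation k d \<Phi> (kron A B) = kron A (\<Phi> B)"
proof (rule eq_matI)
  have \<Phi>B: "\<Phi> B \<in> carrier_mat d d"
    using assms by (auto simp: linear_mat_map_def)
  show "dim_row (ampliation k d \<Phi> (kron A B)) = dim_row (kron A (\<Phi> B))"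
    and "dim_col (ampliation k d \<Phi> (kron A B)) = dim_col (kron A (\<Phi> B))"
    using assms \<Phi>B by (auto simp: ampliation_def kron_def)
  fix i j
  assume "i < dim_row (kron A (\<Phi> B))" "j < dim_col (kron A (\<Phi> B))"
  hence ij: "i < k * d" "j < k * d"
    using assms \<Phi>B by (auto simp: kron_def)
  hence d: "d > 0" by (cases d) auto
  have ab: "i div d < k" "j div d < k"
    using ij by (auto simp: less_mult_imp_div_less)
  have lt: "a * d + p < k * d" if "a < k" "p < d" for a p :: nat
  proof -
    have "a * d + p < Suc a * d" using that by simp
    also have "\<dots> \<le> k * d" using that by (intro mult_le_mono1) simp
    finally show ?thesis .
  qed
  have "mat_block d (kron A B) (i div d) (j div d) = A $$ (i div d, j div d) \<cdot>\<^sub>m B"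
    (is "?L = ?R")
  proof (rule eq_matI)
    fix p q assume "p < dim_row ?R" "q < dim_col ?R"
    hence "p < d" "q < d" using assms by auto
    thus "?L $$ (p, q) = ?R $$ (p, q)"
      using assms ab lt d by (auto simp: mat_block_def kron_def)
  qed (use assms in \<open>auto simp: mat_block_def\<close>)
  thus "ampliation k d \<Phi> (kron A B) $$ (i, j) = kron A (\<Phi> B) $$ (i, j)"
    using assms \<Phi>B ij d by (auto simp: ampliation_def kron_def linear_mat_map_def)
qed

definition k_positive :: "nat \<Rightarrow> nat \<Rightarrow> (complex mat \<Rightarrow> complex mat) \<Rightarrow> bool" where
  "k_positive k d \<Phi> \<longleftrightarrow> linear_mat_map d \<Phi> \<and> positive_map (k * d) (ampliation k d \<Phi>)"

definition completely_positive :: "nat \<Rightarrow> (complex mat \<Rightarrow> complex mat) \<Rightarrow> bool" where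
  "completely_positive d \<Phi> \<longleftrightarrow> (\<forall>k \<ge> 1. k_positive k d \<Phi>)"

definition PPT_map :: "nat \<Rightarrow> (complex mat \<Rightarrow> complex mat) \<Rightarrow> bool" where
  "PPT_map d \<Phi> \<longleftrightarrow> completely_positive d \<Phi> \<and> completely_positive d (transpose_mat \<circ> \<Phi>)"

definition separable_mat :: "nat \<Rightarrow> nat \<Rightarrow> complex mat \<Rightarrow> bool" where
  "separable_mat m n X \<longleftrightarrow> X \<in> psd (m * n) \<and>
     (\<exists>(N :: nat) A B. (\<forall>i < N. A i \<in> psd m \<and> B i \<in> psd n) \<and>
        X = finsum (module_mat TYPE(complex) (m * n) (m * n)) (\<lambda>i. kron (A i) (B i)) {..<N})"

definition k_entanglement_breaking :: "nat \<Rightarrow> nat \<Rightarrow> (complex mat \<Rightarrow> complex mat) \<Rightarrow> bool" where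
  "k_entanglement_breaking k d \<Phi> \<longleftrightarrow> k_positive k d \<Phi> \<and>
     (\<forall>X \<in> psd (k * d). separable_mat k d (ampliation k d \<Phi> X))"

definition orthonormal_family :: "nat \<Rightarrow> nat \<Rightarrow> (nat \<Rightarrow> complex vec) \<Rightarrow> bool" where
  "orthonormal_family n r u \<longleftrightarrow> (\<forall>i < r. u i \<in> carrier_vec n) \<and>
     (\<forall>i < r. \<forall>j < r. u i \<bullet>c u j = (if i = j then 1 else 0))"

definition schmidt_decomposition ::
  "nat \<Rightarrow> nat \<Rightarrow> complex vec \<Rightarrow> nat \<Rightarrow> (nat \<Rightarrow> real) \<Rightarrow> (nat \<Rightarrow> complex vec) \<Rightarrow> (nat \<Rightarrow> complex vec) \<Rightarrow> bool"
where
  "schmidt_decomposition m n \<xi> r c u v \<longleftrightarrow>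
     orthonormal_family m r u \<and> orthonormal_family n r v \<and> (\<forall>i < r. 0 \<le> c i) \<and>
     \<xi> = finsum_vec TYPE(complex) (m * n)
           (\<lambda>i. complex_of_real (c i) \<cdot>\<^sub>v kron_vec (u i) (v i)) {..<r}"

text \<open>
  Every Schmidt decomposition of \<open>\<xi>\<close> has the same number of nonzero coefficients, so \<open>LEAST\<close> only
  serves to select this common value.
\<close>

definition schmidt_rank :: "nat \<Rightarrow> nat \<Rightarrow> complex vec \<Rightarrow> nat" where
  "schmidt_rank m n \<xi> =
     (LEAST s. \<exists>r c u v. schmidt_decomposition m n \<xi> r c u v \<and> s = card {i. i < r \<and> c i \<noteq> 0})"

text \<open>The matrix of \<open>z \<mapsto> \<xi> \<langle>\<xi>, z\<rangle>\<close>, the inner product being linear in the second argument.\<close>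

definition ketbra :: "complex vec \<Rightarrow> complex mat" where
  "ketbra \<xi> = mat (dim_vec \<xi>) (dim_vec \<xi>) (\<lambda>(i, j). \<xi> $ i * cnj (\<xi> $ j))"

definition rank_one_decomposition :: "nat \<Rightarrow> complex mat \<Rightarrow> nat \<Rightarrow> (nat \<Rightarrow> complex vec) \<Rightarrow> bool" where
  "rank_one_decomposition n X N \<xi> \<longleftrightarrow>
     (\<forall>i < N. \<xi> i \<in> carrier_vec n \<and> \<xi> i \<noteq> 0\<^sub>v n) \<and>
     X = finsum (module_mat TYPE(complex) n n) (\<lambda>i. ketbra (\<xi> i)) {..<N}"

text \<open>
  Meaningful for positive semidefinite \<open>X\<close> only. Inserting \<open>0\<close> assigns the value \<open>0\<close> to the maximum
  over the empty decomposition, which is the case \<open>X = 0\<close>.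
\<close>

definition schmidt_number :: "nat \<Rightarrow> nat \<Rightarrow> complex mat \<Rightarrow> nat" where
  "schmidt_number m n X =
     (LEAST s. \<exists>N \<xi>. rank_one_decomposition (m * n) X N \<xi> \<and>
        s = Max (insert 0 ((\<lambda>i. schmidt_rank m n (\<xi> i)) ` {..<N})))"

definition choi_matrix :: "nat \<Rightarrow> (complex mat \<Rightarrow> complex mat) \<Rightarrow> complex mat" where
  "choi_matrix d \<Phi> = finsum (module_mat TYPE(complex) (d * d) (d * d))
     (\<lambda>(i, j). kron (mat_unit d i j) (\<Phi> (mat_unit d i j))) ({..<d} \<times> {..<d})"

definition schmidt_number_map :: "nat \<Rightarrow> (complex mat \<Rightarrow> complex mat) \<Rightarrow> nat" where
  "schmidt_number_map d \<Phi> = schmidt_number d d (choi_matrix d \<Phi>)"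

end

theory Submission
  imports Defs
begin

text \<open>
  A map \<open>\<Phi>\<close> is determined by its Choi matrix, so it suffices to find a good state. Suppose that the Choi
  matrix is supported on \<open>\<complex>\<^sup>2 \<otimes> \<complex>\<^sup>4 \<subseteq> \<complex>\<^sup>d \<otimes> \<complex>\<^sup>d\<close>, and that there it is a state \<open>\<rho>\<close> which is entangled and has
  a positive partial transpose \<open>\<rho>\<^sup>\<Gamma>\<close>. Then all requirements follow. Positivity of \<open>\<rho>\<close> and \<open>\<rho>\<^sup>\<Gamma>\<close> makes \<open>\<Phi>\<close> a
  PPT-map. The image under \<open>id\<^sub>2 \<otimes> \<Phi>\<close> of the projection onto \<open>|00\<rangle> + |11\<rangle>\<close> is \<open>\<rho>\<close> itself, so \<open>\<Phi>\<close> is not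
  \<open>2\<close>-entanglement breaking. The Choi matrices of \<open>\<Phi>\<close> and \<open>\<Phi> \<circ> T\<close> are \<open>\<rho>\<close> and \<open>\<rho>\<^sup>\<Gamma>\<close>; vectors of
  \<open>\<complex>\<^sup>2 \<otimes> \<complex>\<^sup>d\<close> have Schmidt rank at most two, and Schmidt number one would mean separability. So both
  Schmidt numbers are two (\<open>schmidt_number_kraus_map_eq_2\<close>).

  The state is the sum of the projections onto the vectors \<open>4(|00\<rangle> + |11\<rangle>)\<close>, \<open>4(|01\<rangle> + |12\<rangle>)\<close>,
  \<open>4(|02\<rangle> + |13\<rangle>)\<close>, \<open>4|03\<rangle>\<close> and \<open>5|10\<rangle> + 3|13\<rangle>\<close>, a member of the Horodecki family of bound entangled states.
  Because \<open>3\<^sup>2 + 4\<^sup>2 = 5\<^sup>2\<close>, its partial transpose is its mirror image under \<open>p \<mapsto> 3 - p\<close> in the second factor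
  (\<open>flipped_ket_partial_transpose\<close>). So \<open>\<rho>\<^sup>\<Gamma>\<close> is again a sum of projections onto vectors, and \<open>\<Phi>\<close> and
  \<open>T \<circ> \<Phi>\<close> are both given by explicit Kraus operators.

  Entanglement of \<open>\<rho>\<close> is proved by the range criterion. If \<open>\<rho> = \<Sum> |e\<rangle>\<langle>e| \<otimes> B\<close> with \<open>e = (x, y)\<close> and \<open>B \<ge> 0\<close>, then
  every kernel vector of \<open>\<rho>\<close> or of \<open>\<rho>\<^sup>\<Gamma>\<close> yields a linear relation between the columns of each \<open>B\<close>. The
  kernel of \<open>\<rho>\<close> is spanned on \<open>\<complex>\<^sup>2 \<otimes> \<complex>\<^sup>4\<close> by \<open>|00\<rangle> - |11\<rangle>\<close>, \<open>|01\<rangle> - |12\<rangle>\<close> and \<open>5|02\<rangle> - 5|13\<rangle> + 3|10\<rangle>\<close>, that of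
  \<open>\<rho>\<^sup>\<Gamma>\<close> by the mirror images. These six relations leave no room for a nonzero term at \<open>|00\<rangle>\<close>
  (\<open>edge_kernel_product\<close>), contrary to \<open>\<langle>00|\<rho>|00\<rangle> = 16\<close>.
\<close>

section \<open>Tensor indices and sums of matrices\<close>

lemma tensor_index_less:
  fixes a p k d :: nat
  assumes "a < k" "p < d"
  shows "a * d + p < k * d"
proof -
  have "a * d + p < Suc a * d" using assms by simp
  also have "\<dots> \<le> k * d" using assms by (intro mult_le_mono1) simp
  finally show ?thesis .
qed

lemma tensor_index_cases:
  fixes i k d :: nat
  assumes "i < k * d"
  obtains a p where "a < k" "p < d" "i = a * d + p"
proof
  show "i div d < k" "i mod d < d" "i = i div d * d + i mod d"
    using assms by (auto simp: less_mult_imp_div_less intro!: mod_less_divisor gr0I)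
qed

lemma sum_tensor_index: "(\<Sum>i<k * d. f i) = (\<Sum>a<k. \<Sum>p<d. f (a * d + p))"
  for f :: "nat \<Rightarrow> 'a::comm_monoid_add"
proof -
  have "(\<Sum>i<k * d. f i) = (\<Sum>a<k. sum f {a * d..<a * d + d})"
    by (simp add: sum.nat_group)
  also have "\<dots> = (\<Sum>a<k. \<Sum>p<d. f (a * d + p))"
    by (simp add: sum.atLeastLessThan_shift_0[of f] lessThan_atLeast0 add.commute)
  finally show ?thesis .
qed

lemma sum_two: "(\<Sum>l<2::nat. g l) = g 0 + g 1" for g :: "nat \<Rightarrow> complex"
  by (simp add: numeral_2_eq_2)

lemma tensor_mat_eqI:
  assumes "X \<in> carrier_mat (m * n) (m * n)" "Y \<in> carrier_mat (m * n) (m * n)"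
    and "\<And>i p j q. i < m \<Longrightarrow> p < n \<Longrightarrow> j < m \<Longrightarrow> q < n \<Longrightarrow>
           X $$ (i * n + p, j * n + q) = Y $$ (i * n + p, j * n + q)"
  shows "X = Y"
proof (rule eq_matI)
  fix s t assume "s < dim_row Y" "t < dim_col Y"
  then obtain i p j q where "i < m" "p < n" "s = i * n + p" "j < m" "q < n" "t = j * n + q"
    using assms(2) by (metis carrier_matD tensor_index_cases)
  then show "X $$ (s, t) = Y $$ (s, t)" using assms(3) by simp
qed (use assms in auto)

lemma finsum_mat_carrier_index:
  assumes "finite S" and "\<And>k. k \<in> S \<Longrightarrow> F k \<in> carrier_mat n n"
  shows "finsum (module_mat TYPE(complex) n n) F S \<in> carrier_mat n n \<and>
    (\<forall>i<n. \<forall>j<n. finsum (module_mat TYPE(complex) n n) F S $$ (i, j) = (\<Sum>k\<in>S. F k $$ (i, j)))"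
  using assms
proof (induction S rule: finite_induct)
  case empty
  interpret M: abelian_group "module_mat TYPE(complex) n n" by (rule abelian_group_mat)
  show ?case by (simp add: M.finsum_empty module_mat_simps)
next
  case (insert x S)
  interpret M: abelian_group "module_mat TYPE(complex) n n" by (rule abelian_group_mat)
  have F: "F \<in> S \<rightarrow> carrier (module_mat TYPE(complex) n n)"
    "F x \<in> carrier (module_mat TYPE(complex) n n)"
    using insert.prems by (auto simp: module_mat_simps)
  have "finsum (module_mat TYPE(complex) n n) F (insert x S)
      = F x + finsum (module_mat TYPE(complex) n n) F S"
    using M.finsum_insert[OF insert.hyps F] by (simp add: module_mat_simps)
  then show ?case using insert by auto
qed

lemmas finsum_mat_carrier = finsum_mat_carrier_index[THEN conjunct1]
lemmas finsum_mat_index = finsum_mat_carrier_index[THEN conjunct2, rule_format]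

section \<open>Positive semidefinite matrices\<close>

lemma psd_iff_form:
  assumes A: "A \<in> carrier_mat n n"
  shows "A \<in> psd n \<longleftrightarrow> (\<forall>f. 0 \<le> (\<Sum>p<n. \<Sum>q<n. cnj (f p) * A $$ (p, q) * f q))"
proof -
  have form: "(A *\<^sub>v v) \<bullet>c v = (\<Sum>p<n. \<Sum>q<n. cnj (v $ p) * A $$ (p, q) * v $ q)"
    if "v \<in> carrier_vec n" for v
    using that A by (auto simp: scalar_prod_def sum_distrib_left sum_distrib_right
        conjugate_complex_def lessThan_atLeast0 ac_simps intro!: sum.cong)
  show ?thesis
  proof
    assume P: "A \<in> psd n"
    show "\<forall>f. 0 \<le> (\<Sum>p<n. \<Sum>q<n. cnj (f p) * A $$ (p, q) * f q)"
    proof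
      fix f
      have "0 \<le> (A *\<^sub>v vec n f) \<bullet>c vec n f" using P by (simp add: psd_def)
      then show "0 \<le> (\<Sum>p<n. \<Sum>q<n. cnj (f p) * A $$ (p, q) * f q)"
        by (simp add: form)
    qed
  next
    assume "\<forall>f. 0 \<le> (\<Sum>p<n. \<Sum>q<n. cnj (f p) * A $$ (p, q) * f q)"
    then show "A \<in> psd n" using A form by (simp add: psd_def)
  qed
qed

lemma mult_cnj_self_nonneg: "0 \<le> z * cnj z" for z :: complex
  by (simp add: less_eq_complex_def)

lemma outer_product_form:
  fixes g f :: "nat \<Rightarrow> complex"
  shows "(\<Sum>p<n. \<Sum>q<n. cnj (f p) * (g p * cnj (g q)) * f q)
    = (\<Sum>p<n. cnj (f p) * g p) * cnj (\<Sum>p<n. cnj (f p) * g p)"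
  by (subst sum.swap) (simp add: sum_product ac_simps)

lemma ketbra_psd: "ketbra x \<in> psd (dim_vec x)"
proof -
  have "0 \<le> (\<Sum>p<dim_vec x. \<Sum>q<dim_vec x. cnj (f p) * ketbra x $$ (p, q) * f q)" for f
  proof -
    have "(\<Sum>p<dim_vec x. \<Sum>q<dim_vec x. cnj (f p) * ketbra x $$ (p, q) * f q)
        = (\<Sum>p<dim_vec x. \<Sum>q<dim_vec x. cnj (f p) * (x $ p * cnj (x $ q)) * f q)"
      by (simp add: ketbra_def)
    also have "0 \<le> \<dots>" unfolding outer_product_form by (rule mult_cnj_self_nonneg)
    finally show ?thesis .
  qed
  then show ?thesis by (subst psd_iff_form) (auto simp: ketbra_def)
qed

text \<open>
  Testing the form at \<open>(1, 0)\<close>, \<open>(0, 1)\<close>, \<open>(1, 1)\<close> and \<open>(1, \<i>)\<close> shows that its coefficient matrix is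
  Hermitian with nonnegative diagonal. Along the line \<open>(1, - t \<cdot> cnj b)\<close> it is a real quadratic in \<open>t\<close>,
  and nonnegativity of that quadratic bounds \<open>b\<close> by the diagonal. For \<open>a = 0\<close> this says that the
  off-diagonal entries vanish, the Cauchy-Schwarz argument behind kernels of positive matrices.
\<close>

lemma positive_binary_form:
  fixes a b c d :: complex
  assumes pos: "\<And>x y. 0 \<le> a * (cnj x * x) + b * (cnj x * y) + c * (cnj y * x) + d * (cnj y * y)"
  shows "0 \<le> a" "0 \<le> d" "c = cnj b" "cmod b ^ 2 \<le> Re a * Re d"
proof -
  show a: "0 \<le> a" using pos[of 1 0] by simp
  show d: "0 \<le> d" using pos[of 0 1] by simp
  show c: "c = cnj b"
    using pos[of 1 1] pos[of 1 \<i>] a d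
    by (auto simp: less_eq_complex_def complex_eq_iff)
  define B where "B = (cmod b)\<^sup>2"
  have bb: "b * cnj b = of_real B" unfolding B_def by (rule complex_norm_square[symmetric])
  have ad: "a = of_real (Re a)" "d = of_real (Re d)" "Re a \<ge> 0" "Re d \<ge> 0"
    using a d by (auto simp: less_eq_complex_def complex_eq_iff)
  have key: "0 \<le> Re a - 2 * t * B + t\<^sup>2 * (Re d * B)" for t :: real
  proof -
    have "a * (cnj 1 * 1) + b * (cnj 1 * (- of_real t * cnj b)) + c * (cnj (- of_real t * cnj b) * 1)
        + d * (cnj (- of_real t * cnj b) * (- of_real t * cnj b))
        = a - 2 * of_real t * (b * cnj b) + of_real t ^ 2 * (d * (b * cnj b))"
      unfolding c by (simp add: algebra_simps power2_eq_square)
    also have "\<dots> = of_real (Re a - 2 * t * B + t\<^sup>2 * (Re d * B))"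
      unfolding bb by (subst ad(1), subst ad(2)) simp
    finally show ?thesis using pos[of 1 "- of_real t * cnj b"]
      by (simp add: less_eq_complex_def del: of_real_add of_real_diff of_real_mult)
  qed
  have "B \<le> Re a * Re d"
  proof (cases "Re d = 0")
    case True
    have "B = 0"
    proof (rule ccontr)
      assume "B \<noteq> 0"
      then show False using key[of "(Re a + 1) / (2 * B)"] True by simp
    qed
    then show ?thesis using True by simp
  next
    case False
    then have "Re d > 0" using ad(4) by simp
    then show ?thesis using key[of "1 / Re d"] by (simp add: field_simps power2_eq_square)
  qed
  then show "cmod b ^ 2 \<le> Re a * Re d" by (simp add: B_def)
qed

lemma psd_form_nonneg: "0 \<le> (\<Sum>p<n. \<Sum>q<n. cnj (f p) * A $$ (p, q) * f q)" if "A \<in> psd n"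
  using that psd_iff_form[of A n] unfolding psd_def by blast

text \<open>
  Restricting the form of \<open>B\<close> to the span of \<open>w\<close> and a basis vector gives a positive binary form whose
  first diagonal coefficient is zero, so its off-diagonal coefficient, a coordinate of \<open>B w\<close>, is zero.
\<close>

lemma psd_kernel:
  fixes w :: "nat \<Rightarrow> complex"
  assumes B: "B \<in> psd n" and zero: "(\<Sum>p<n. \<Sum>q<n. cnj (w p) * B $$ (p, q) * w q) = 0" and r: "r < n"
  shows "(\<Sum>q<n. B $$ (r, q) * w q) = 0"
proof -
  let ?b = "\<Sum>p<n. cnj (w p) * B $$ (p, r)" and ?c = "\<Sum>q<n. B $$ (r, q) * w q"
  have pos: "0 \<le> 0 * (cnj x * x) + ?b * (cnj x * y) + ?c * (cnj y * x) + B $$ (r, r) * (cnj y * y)"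
    for x y
  proof -
    define u where "u = (\<lambda>p. if p = r then 1 else 0 :: complex)"
    have delta: "(\<Sum>p<n. cnj (u p) * g p) = g r" "(\<Sum>p<n. g p * u p) = g r" for g
    proof -
      have "cnj (u p) * g p = (if p = r then g p else 0)" "g p * u p = (if p = r then g p else 0)" for p
        by (simp_all add: u_def)
      then show "(\<Sum>p<n. cnj (u p) * g p) = g r" "(\<Sum>p<n. g p * u p) = g r"
        using r by simp_all
    qed
    let ?f = "\<lambda>p. x * w p + y * u p"
    have "(\<Sum>p<n. \<Sum>q<n. cnj (?f p) * B $$ (p, q) * ?f q)
       = (\<Sum>p<n. \<Sum>q<n. cnj x * x * (cnj (w p) * B $$ (p, q) * w q)
            + cnj x * y * (cnj (w p) * (B $$ (p, q) * u q))
            + cnj y * x * (cnj (u p) * (B $$ (p, q) * w q))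
            + cnj y * y * (cnj (u p) * (B $$ (p, q) * u q)))"
      by (intro sum.cong refl) (simp add: algebra_simps)
    also have "\<dots> = cnj x * x * (\<Sum>p<n. \<Sum>q<n. cnj (w p) * B $$ (p, q) * w q)
            + cnj x * y * (\<Sum>p<n. cnj (w p) * (\<Sum>q<n. B $$ (p, q) * u q))
            + cnj y * x * (\<Sum>p<n. cnj (u p) * (\<Sum>q<n. B $$ (p, q) * w q))
            + cnj y * y * (\<Sum>p<n. cnj (u p) * (\<Sum>q<n. B $$ (p, q) * u q))"
      by (simp only: sum.distrib sum_distrib_left)
    also have "\<dots> = 0 * (cnj x * x) + ?b * (cnj x * y) + ?c * (cnj y * x) + B $$ (r, r) * (cnj y * y)"
      unfolding zero delta by simp
    finally have eq: "(\<Sum>p<n. \<Sum>q<n. cnj (?f p) * B $$ (p, q) * ?f q)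
        = 0 * (cnj x * x) + ?b * (cnj x * y) + ?c * (cnj y * x) + B $$ (r, r) * (cnj y * y)" .
    show ?thesis unfolding eq[symmetric] by (rule psd_form_nonneg[OF B])
  qed
  have c: "?c = cnj ?b" and b: "cmod ?b ^ 2 \<le> Re 0 * Re (B $$ (r, r))"
    by (rule positive_binary_form[OF pos])+
  from b have "?b = 0" by simp
  then show ?thesis unfolding c by simp
qed

text \<open>
  The Cholesky factorisation. It replaces the first factor of a separable decomposition by rank-one
  matrices, so that the same argument covers arbitrary separable matrices and sums of product vectors.
\<close>

lemma psd_2_gram:
  assumes A: "A \<in> psd 2"
  obtains e :: "nat \<Rightarrow> nat \<Rightarrow> complex"
  where "\<And>i j. i < 2 \<Longrightarrow> j < 2 \<Longrightarrow> A $$ (i, j) = (\<Sum>l<2. e l i * cnj (e l j))"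
proof -
  let ?a = "A $$ (0, 0)" and ?b = "A $$ (0, 1)" and ?c = "A $$ (1, 0)" and ?d = "A $$ (1, 1)"
  have pos: "0 \<le> ?a * (cnj x * x) + ?b * (cnj x * y) + ?c * (cnj y * x) + ?d * (cnj y * y)" for x y
  proof -
    have "0 \<le> (\<Sum>p<2. \<Sum>q<2. cnj (if p = 0 then x else y) * A $$ (p, q) * (if q = 0 then x else y))"
      by (rule psd_form_nonneg[OF A])
    then show ?thesis unfolding sum_two by (simp add: algebra_simps)
  qed
  note bf = positive_binary_form[OF pos]
  define a b d where "a = Re ?a" and "b = ?b" and "d = Re ?d"
  have ent: "?a = of_real a" "?b = b" "?c = cnj b" "?d = of_real d" "0 \<le> a" "0 \<le> d" "cmod b ^ 2 \<le> a * d"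
    using bf by (auto simp: a_def b_def d_def less_eq_complex_def complex_eq_iff)
  have idx: "i = 0 \<or> i = 1" if "i < 2" for i :: nat using that by auto
  show ?thesis
  proof (cases "a = 0")
    case True
    then have b: "b = 0" using ent(7) by simp
    show ?thesis
    proof (rule that)
      have sd: "of_real (sqrt d) * of_real (sqrt d) = (of_real d :: complex)"
        using ent(6) by (simp flip: of_real_mult)
      let ?e = "\<lambda>(l :: nat) i. if l = 1 \<and> i = 1 then of_real (sqrt d) else 0 :: complex"
      show "A $$ (i, j) = (\<Sum>l<2. ?e l i * cnj (?e l j))" if "i < 2" "j < 2" for i j :: nat
        using idx[OF that(1)] idx[OF that(2)] ent(1-4) b True sd by (auto simp: sum_two)
    qed
  next
    case False
    with ent have a: "a > 0" by simp
    then have s: "d - cmod b ^ 2 / a \<ge> 0" using ent(7) by (simp add: field_simps)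
    define e :: "nat \<Rightarrow> nat \<Rightarrow> complex" where "e = (\<lambda>l i. if l = 0 then (if i = 0 then of_real (sqrt a) else cnj b / of_real (sqrt a))
       else (if i = 0 then 0 else of_real (sqrt (d - cmod b ^ 2 / a))))"
    have sa: "of_real (sqrt a) * of_real (sqrt a) = (of_real a :: complex)" "sqrt a \<noteq> 0"
      using a by (auto simp flip: of_real_mult)
    have "cnj b / of_real (sqrt a) * cnj (cnj b / of_real (sqrt a))
        + of_real (sqrt (d - cmod b ^ 2 / a)) * cnj (of_real (sqrt (d - cmod b ^ 2 / a))) = of_real d"
    proof -
      have "cnj b / of_real (sqrt a) * cnj (cnj b / of_real (sqrt a)) = (b * cnj b) / of_real a"
        using sa by (simp add: mult.commute)
      also have "\<dots> = of_real (cmod b ^ 2 / a)"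
        by (simp only: complex_norm_square[symmetric] of_real_divide)
      finally have 1: "cnj b / of_real (sqrt a) * cnj (cnj b / of_real (sqrt a)) = of_real (cmod b ^ 2 / a)" .
      have 2: "of_real (sqrt (d - cmod b ^ 2 / a)) * cnj (of_real (sqrt (d - cmod b ^ 2 / a)))
          = (of_real (d - cmod b ^ 2 / a) :: complex)"
        using s by (simp flip: of_real_mult)
      show ?thesis unfolding 1 2 by simp
    qed
    then have "A $$ (i, j) = (\<Sum>l<2. e l i * cnj (e l j))" if "i < 2" "j < 2" for i j
      using idx[OF that(1)] idx[OF that(2)] ent sa
      by (auto simp: sum_two e_def)
    then show ?thesis by (rule that)
  qed
qed

section \<open>Kraus maps and their Choi matrices\<close>

text \<open>
  The completely positive map with Kraus operators \<open>V\<^sub>l = (w l i p)\<close>, in the form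
  \<open>\<Sum>\<^sub>l V\<^sub>l\<^sup>T A cnj V\<^sub>l\<close>. With this convention its Choi matrix is the sum of the projections onto the
  vectors \<open>w l \<in> \<complex>\<^sup>d \<otimes> \<complex>\<^sup>d\<close>.
\<close>

definition kraus_map ::
  "nat \<Rightarrow> nat \<Rightarrow> (nat \<Rightarrow> nat \<Rightarrow> nat \<Rightarrow> complex) \<Rightarrow> complex mat \<Rightarrow> complex mat" where
  "kraus_map d N w A = mat d d
     (\<lambda>(p, q). \<Sum>l<N. \<Sum>i<d. \<Sum>j<d. w l i p * A $$ (i, j) * cnj (w l j q))"

lemma kraus_map_carrier [simp]: "kraus_map d N w A \<in> carrier_mat d d"
  by (simp add: kraus_map_def)

lemma kraus_map_linear: "linear_mat_map d (kraus_map d N w)"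
proof -
  have "kraus_map d N w (A + B) = kraus_map d N w A + kraus_map d N w B"
    if "A \<in> carrier_mat d d" "B \<in> carrier_mat d d" for A B
    using that by (intro eq_matI) (auto simp: kraus_map_def algebra_simps sum.distrib)
  moreover have "kraus_map d N w (c \<cdot>\<^sub>m A) = c \<cdot>\<^sub>m kraus_map d N w A"
    if "A \<in> carrier_mat d d" for A c
    using that by (intro eq_matI) (auto simp: kraus_map_def algebra_simps sum_distrib_left)
  ultimately show ?thesis by (simp add: linear_mat_map_def)
qed

lemma mat_block_carrier [simp]: "mat_block d X a b \<in> carrier_mat d d"
  by (simp add: mat_block_def)

lemma mat_block_index: "p < d \<Longrightarrow> q < d \<Longrightarrow> mat_block d X a b $$ (p, q) = X $$ (a * d + p, b * d + q)"
  by (simp add: mat_block_def)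

lemma ampliation_carrier [simp]: "ampliation k d \<Phi> X \<in> carrier_mat (k * d) (k * d)"
  by (simp add: ampliation_def)

lemma ampliation_index:
  assumes "a < k" "p < d" "b < k" "q < d"
  shows "ampliation k d \<Phi> X $$ (a * d + p, b * d + q) = \<Phi> (mat_block d X a b) $$ (p, q)"
  using assms tensor_index_less[of a k p d] tensor_index_less[of b k q d]
  by (simp add: ampliation_def)

lemma ampliation_linear:
  assumes \<Phi>: "linear_mat_map d \<Phi>"
  shows "linear_mat_map (k * d) (ampliation k d \<Phi>)"
proof -
  have \<Phi>c: "\<Phi> A \<in> carrier_mat d d" if "A \<in> carrier_mat d d" for A
    using \<Phi> that by (simp add: linear_mat_map_def)
  have "ampliation k d \<Phi> (A + B) = ampliation k d \<Phi> A + ampliation k d \<Phi> B"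
    if AB: "A \<in> carrier_mat (k * d) (k * d)" "B \<in> carrier_mat (k * d) (k * d)" for A B
  proof (rule tensor_mat_eqI)
    fix a p b q assume lt: "a < k" "p < d" "b < k" "q < d"
    have "mat_block d (A + B) a b = mat_block d A a b + mat_block d B a b"
      using AB lt tensor_index_less by (intro eq_matI) (auto simp: mat_block_def)
    moreover have "\<Phi> (mat_block d A a b + mat_block d B a b) = \<Phi> (mat_block d A a b) + \<Phi> (mat_block d B a b)"
      using \<Phi> by (simp add: linear_mat_map_def)
    ultimately show "ampliation k d \<Phi> (A + B) $$ (a * d + p, b * d + q)
        = (ampliation k d \<Phi> A + ampliation k d \<Phi> B) $$ (a * d + p, b * d + q)"
      using lt carrier_matD[OF \<Phi>c[OF mat_block_carrier]] carrier_matD[OF ampliation_carrier]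
        tensor_index_less[of a k p d] tensor_index_less[of b k q d]
      by (simp add: ampliation_index)
  qed simp_all
  moreover have "ampliation k d \<Phi> (c \<cdot>\<^sub>m A) = c \<cdot>\<^sub>m ampliation k d \<Phi> A"
    if A: "A \<in> carrier_mat (k * d) (k * d)" for A c
  proof (rule tensor_mat_eqI)
    fix a p b q assume lt: "a < k" "p < d" "b < k" "q < d"
    have "mat_block d (c \<cdot>\<^sub>m A) a b = c \<cdot>\<^sub>m mat_block d A a b"
      using A lt tensor_index_less by (intro eq_matI) (auto simp: mat_block_def)
    moreover have "\<Phi> (c \<cdot>\<^sub>m mat_block d A a b) = c \<cdot>\<^sub>m \<Phi> (mat_block d A a b)"
      using \<Phi> by (simp add: linear_mat_map_def)
    ultimately show "ampliation k d \<Phi> (c \<cdot>\<^sub>m A) $$ (a * d + p, b * d + q)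
        = (c \<cdot>\<^sub>m ampliation k d \<Phi> A) $$ (a * d + p, b * d + q)"
      using lt carrier_matD[OF \<Phi>c[OF mat_block_carrier]] carrier_matD[OF ampliation_carrier]
        tensor_index_less[of a k p d] tensor_index_less[of b k q d]
      by (simp add: ampliation_index)
  qed simp_all
  ultimately show ?thesis by (simp add: linear_mat_map_def)
qed

text \<open>
  Each range is moved inwards past all the others; doing this for \<open>P\<close> before \<open>Q\<close> keeps their order.
\<close>

lemma sum_rotate_5:
  fixes T :: "'a \<Rightarrow> 'b \<Rightarrow> 'c \<Rightarrow> 'd \<Rightarrow> 'e \<Rightarrow> complex"
  shows "(\<Sum>p\<in>P. \<Sum>q\<in>Q. \<Sum>l\<in>L. \<Sum>i\<in>I. \<Sum>j\<in>J. T p q l i j)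
    = (\<Sum>l\<in>L. \<Sum>i\<in>I. \<Sum>j\<in>J. \<Sum>p\<in>P. \<Sum>q\<in>Q. T p q l i j)"
  by (simp only: sum.swap[of _ _ P]) (simp only: sum.swap[of _ _ Q])

lemma kraus_block_form:
  fixes g h :: "nat \<Rightarrow> complex"
  shows "(\<Sum>p<d. \<Sum>q<d. cnj (g p) * (\<Sum>l<N. \<Sum>i<d. \<Sum>j<d. w l i p * X i j * cnj (w l j q)) * h q)
    = (\<Sum>l<N. \<Sum>i<d. \<Sum>j<d.
        cnj (\<Sum>p<d. cnj (w l i p) * g p) * X i j * (\<Sum>q<d. cnj (w l j q) * h q))"
proof -
  have "(\<Sum>p<d. \<Sum>q<d. cnj (g p) * (\<Sum>l<N. \<Sum>i<d. \<Sum>j<d. w l i p * X i j * cnj (w l j q)) * h q)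
    = (\<Sum>p<d. \<Sum>q<d. \<Sum>l<N. \<Sum>i<d. \<Sum>j<d. cnj (g p) * (w l i p * X i j * cnj (w l j q)) * h q)"
    by (simp only: sum_distrib_left sum_distrib_right)
  also have "\<dots> = (\<Sum>l<N. \<Sum>i<d. \<Sum>j<d. \<Sum>p<d. \<Sum>q<d. cnj (g p) * (w l i p * X i j * cnj (w l j q)) * h q)"
    by (rule sum_rotate_5)
  also have "\<dots> = (\<Sum>l<N. \<Sum>i<d. \<Sum>j<d.
        cnj (\<Sum>p<d. cnj (w l i p) * g p) * X i j * (\<Sum>q<d. cnj (w l j q) * h q))"
    by (simp add: sum_distrib_left sum_distrib_right ac_simps)
  finally show ?thesis .
qed

text \<open>
  The form of \<open>(id \<otimes> \<Phi>)(X)\<close> at \<open>f\<close> is the sum over \<open>l\<close> of the form of \<open>X\<close> at \<open>(1 \<otimes> cnj V\<^sub>l) f\<close>, which is \<open>u l\<close>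
  below.
\<close>

lemma kraus_map_completely_positive: "completely_positive d (kraus_map d N w)"
proof -
  let ?\<Phi> = "kraus_map d N w"
  have "ampliation k d ?\<Phi> X \<in> psd (k * d)" if X: "X \<in> psd (k * d)" for k X
    unfolding psd_iff_form[OF ampliation_carrier]
  proof
    fix f :: "nat \<Rightarrow> complex"
    define u where "u = (\<lambda>l b j. \<Sum>q<d. cnj (w l j q) * f (b * d + q))"
    have "(\<Sum>s<k * d. \<Sum>t<k * d. cnj (f s) * ampliation k d ?\<Phi> X $$ (s, t) * f t)
      = (\<Sum>a<k. \<Sum>p<d. \<Sum>b<k. \<Sum>q<d. cnj (f (a * d + p)) *
           (\<Sum>l<N. \<Sum>i<d. \<Sum>j<d. w l i p * X $$ (a * d + i, b * d + j) * cnj (w l j q)) * f (b * d + q))"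
      unfolding sum_tensor_index
      by (intro sum.cong refl) (simp add: ampliation_index kraus_map_def mat_block_index)
    also have "\<dots> = (\<Sum>a<k. \<Sum>b<k. \<Sum>p<d. \<Sum>q<d. cnj (f (a * d + p)) *
           (\<Sum>l<N. \<Sum>i<d. \<Sum>j<d. w l i p * X $$ (a * d + i, b * d + j) * cnj (w l j q)) * f (b * d + q))"
      by (rule sum.cong[OF refl], rule sum.swap)
    also have "\<dots> = (\<Sum>a<k. \<Sum>b<k. \<Sum>l<N. \<Sum>i<d. \<Sum>j<d.
           cnj (u l a i) * X $$ (a * d + i, b * d + j) * u l b j)"
      unfolding u_def by (rule sum.cong[OF refl], rule sum.cong[OF refl], rule kraus_block_form)
    also have "\<dots> = (\<Sum>a<k. \<Sum>l<N. \<Sum>b<k. \<Sum>i<d. \<Sum>j<d.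
           cnj (u l a i) * X $$ (a * d + i, b * d + j) * u l b j)"
      by (rule sum.cong[OF refl], rule sum.swap)
    also have "\<dots> = (\<Sum>l<N. \<Sum>a<k. \<Sum>b<k. \<Sum>i<d. \<Sum>j<d.
           cnj (u l a i) * X $$ (a * d + i, b * d + j) * u l b j)"
      by (rule sum.swap)
    also have "\<dots> = (\<Sum>l<N. \<Sum>a<k. \<Sum>i<d. \<Sum>b<k. \<Sum>j<d.
           cnj (u l a i) * X $$ (a * d + i, b * d + j) * u l b j)"
      by (rule sum.cong[OF refl], rule sum.cong[OF refl], rule sum.swap)
    also have "\<dots> = (\<Sum>l<N. \<Sum>s<k * d. \<Sum>t<k * d.
           cnj (u l (s div d) (s mod d)) * X $$ (s, t) * u l (t div d) (t mod d))"
      unfolding sum_tensor_index by (intro sum.cong refl) simp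
    also have "0 \<le> \<dots>"
      by (rule sum_nonneg) (rule psd_form_nonneg[OF X])
    finally show "0 \<le> (\<Sum>s<k * d. \<Sum>t<k * d. cnj (f s) * ampliation k d ?\<Phi> X $$ (s, t) * f t)" .
  qed
  then show ?thesis
    by (simp add: completely_positive_def k_positive_def positive_map_def kraus_map_linear ampliation_linear)
qed

lemma kraus_map_mat_unit:
  assumes "i < d" "j < d" "p < d" "q < d"
  shows "kraus_map d N w (mat_unit d i j) $$ (p, q) = (\<Sum>l<N. w l i p * cnj (w l j q))"
proof -
  have "(\<Sum>i'<d. \<Sum>j'<d. w l i' p * mat_unit d i j $$ (i', j') * cnj (w l j' q)) = w l i p * cnj (w l j q)" for l
  proof -
    have "(\<Sum>i'<d. \<Sum>j'<d. w l i' p * mat_unit d i j $$ (i', j') * cnj (w l j' q))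
      = (\<Sum>i'<d. if i' = i then (\<Sum>j'<d. if j' = j then w l i p * cnj (w l j q) else 0) else 0)"
    proof (intro sum.cong refl)
      fix i' assume i': "i' \<in> {..<d}"
      show "(\<Sum>j'<d. w l i' p * mat_unit d i j $$ (i', j') * cnj (w l j' q))
        = (if i' = i then (\<Sum>j'<d. if j' = j then w l i p * cnj (w l j q) else 0) else 0)"
      proof (cases "i' = i")
        case True
        show ?thesis unfolding if_P[OF True]
          by (rule sum.cong) (use True i' assms in \<open>auto simp: mat_unit_def\<close>)
      next
        case False
        show ?thesis unfolding if_not_P[OF False]
          by (rule sum.neutral) (use False i' in \<open>auto simp: mat_unit_def\<close>)
      qed
    qed
    then show ?thesis using assms by simp
  qed
  then show ?thesis using assms by (simp add: kraus_map_def)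
qed

lemma kron_carrier: "A \<in> carrier_mat m m \<Longrightarrow> B \<in> carrier_mat n n \<Longrightarrow> kron A B \<in> carrier_mat (m * n) (m * n)"
  by (simp add: kron_def)

lemma mat_unit_carrier [simp]: "mat_unit d i j \<in> carrier_mat d d"
  by (simp add: mat_unit_def)

lemma choi_matrix_carrier:
  assumes "\<And>A. \<Phi> A \<in> carrier_mat d d"
  shows "choi_matrix d \<Phi> \<in> carrier_mat (d * d) (d * d)"
  unfolding choi_matrix_def
  by (rule finsum_mat_carrier) (use assms in \<open>auto intro: kron_carrier\<close>)

lemma choi_matrix_index:
  assumes \<Phi>: "\<And>A. \<Phi> A \<in> carrier_mat d d" and lt: "i < d" "p < d" "j < d" "q < d"
  shows "choi_matrix d \<Phi> $$ (i * d + p, j * d + q) = \<Phi> (mat_unit d i j) $$ (p, q)"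
proof -
  let ?F = "\<lambda>(a, b). kron (mat_unit d a b) (\<Phi> (mat_unit d a b))"
  note idx = tensor_index_less[OF lt(1,2)] tensor_index_less[OF lt(3,4)]
  have dim: "dim_row (\<Phi> A) = d" "dim_col (\<Phi> A) = d" for A using \<Phi>[of A] by auto
  have "choi_matrix d \<Phi> $$ (i * d + p, j * d + q)
      = (\<Sum>x\<in>{..<d} \<times> {..<d}. ?F x $$ (i * d + p, j * d + q))"
    unfolding choi_matrix_def
    by (rule finsum_mat_index) (use idx \<Phi> in \<open>auto intro: kron_carrier\<close>)
  also have "\<dots> = (\<Sum>x\<in>{..<d} \<times> {..<d}. if x = (i, j) then \<Phi> (mat_unit d i j) $$ (p, q) else 0)"
  proof (intro sum.cong refl)
    fix x assume "x \<in> {..<d} \<times> {..<d}"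
    then obtain a b where "x = (a, b)" "a < d" "b < d" by auto
    then show "?F x $$ (i * d + p, j * d + q) = (if x = (i, j) then \<Phi> (mat_unit d i j) $$ (p, q) else 0)"
      using idx lt by (auto simp: kron_def mat_unit_def dim)
  qed
  also have "\<dots> = \<Phi> (mat_unit d i j) $$ (p, q)" using lt by simp
  finally show ?thesis .
qed

lemma choi_kraus_map:
  fixes w :: "nat \<Rightarrow> nat \<Rightarrow> nat \<Rightarrow> complex"
  shows "choi_matrix d (kraus_map d N w) \<in> carrier_mat (d * d) (d * d)"
    and "i < d \<Longrightarrow> p < d \<Longrightarrow> j < d \<Longrightarrow> q < d \<Longrightarrow>
      choi_matrix d (kraus_map d N w) $$ (i * d + p, j * d + q) = (\<Sum>l<N. w l i p * cnj (w l j q))"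
  by (simp_all add: choi_matrix_carrier choi_matrix_index kraus_map_mat_unit)

section \<open>Schmidt decompositions\<close>

lemma kron_vec_carrier: "u \<in> carrier_vec m \<Longrightarrow> v \<in> carrier_vec n \<Longrightarrow> kron_vec u v \<in> carrier_vec (m * n)"
  unfolding kron_vec_def carrier_vec_def mem_Collect_eq dim_vec by (erule (1) arg_cong2)

lemma schmidt_decomposition_index:
  assumes "schmidt_decomposition m n \<xi> r c u v" "a < m" "p < n"
  shows "\<xi> $ (a * n + p) = (\<Sum>i<r. of_real (c i) * (u i $ a * v i $ p))"
proof -
  let ?F = "\<lambda>i. complex_of_real (c i) \<cdot>\<^sub>v kron_vec (u i) (v i)"
  have uv: "\<And>i. i < r \<Longrightarrow> u i \<in> carrier_vec m" "\<And>i. i < r \<Longrightarrow> v i \<in> carrier_vec n"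
    and \<xi>: "\<xi> = finsum_vec TYPE(complex) (m * n) ?F {..<r}"
    using assms(1) by (auto simp: schmidt_decomposition_def orthonormal_family_def)
  note idx = tensor_index_less[OF assms(2,3)]
  have "\<xi> $ (a * n + p) = (\<Sum>i<r. ?F i $ (a * n + p))"
    unfolding \<xi> by (rule index_finsum_vec) (use idx uv in \<open>auto intro!: kron_vec_carrier\<close>)
  also have "\<dots> = (\<Sum>i<r. of_real (c i) * (u i $ a * v i $ p))"
    by (intro sum.cong refl) (use idx uv[THEN carrier_vecD] assms(2,3) in \<open>simp add: kron_vec_def\<close>)
  finally show ?thesis .
qed

lemma cscalar_prod_sum: "u \<in> carrier_vec n \<Longrightarrow> v \<in> carrier_vec n \<Longrightarrow> u \<bullet>c v = (\<Sum>p<n. u $ p * cnj (v $ p))"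
  for u v :: "complex vec"
  by (simp add: scalar_prod_def lessThan_atLeast0 conjugate_complex_def)

text \<open>
  An expansion along an orthonormal family with orthogonal, unnormalised partners \<open>h i\<close> becomes a
  Schmidt decomposition once the partners are normalised. Partners that vanish cannot be normalised,
  so those terms are dropped and the others are renumbered by \<open>\<sigma>\<close>.
\<close>

lemma schmidt_decomposition_of_orthogonal:
  fixes h :: "nat \<Rightarrow> nat \<Rightarrow> complex"
  assumes \<xi>: "\<xi> \<in> carrier_vec (m * n)" and u: "orthonormal_family m r u"
    and h: "\<And>i j. i < r \<Longrightarrow> j < r \<Longrightarrow> i \<noteq> j \<Longrightarrow> (\<Sum>p<n. h i p * cnj (h j p)) = 0"
    and expand: "\<And>a p. a < m \<Longrightarrow> p < n \<Longrightarrow> \<xi> $ (a * n + p) = (\<Sum>i<r. u i $ a * h i p)"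
  obtains s c u' v where "schmidt_decomposition m n \<xi> s c u' v" "s \<le> r"
proof -
  define I where "I = {i. i < r \<and> (\<exists>p<n. h i p \<noteq> 0)}"
  have I: "finite I" "I \<subseteq> {..<r}" by (auto simp: I_def)
  obtain \<sigma> where \<sigma>: "bij_betw \<sigma> {..<card I} I"
    using ex_bij_betw_nat_finite[OF I(1)] by (auto simp: lessThan_atLeast0)
  define N where "N = (\<lambda>i. sqrt (\<Sum>p<n. (cmod (h i p))\<^sup>2))"
  have N: "(\<Sum>p<n. h i p * cnj (h i p)) = of_real (N i) * of_real (N i)" for i
  proof -
    have "(\<Sum>p<n. h i p * cnj (h i p)) = of_real (\<Sum>p<n. (cmod (h i p))\<^sup>2)"
      by (simp only: of_real_sum complex_norm_square)
    also have "\<dots> = of_real (N i) * of_real (N i)"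
      unfolding N_def of_real_mult[symmetric] by (simp add: sum_nonneg)
    finally show ?thesis .
  qed
  have Npos: "N i > 0" if "i \<in> I" for i
  proof -
    have "0 < (\<Sum>p<n. (cmod (h i p))\<^sup>2)"
      using that by (auto simp: I_def intro!: sum_pos2)
    then show ?thesis by (simp add: N_def)
  qed
  define c where "c = (\<lambda>t. N (\<sigma> t))"
  define u' where "u' = (\<lambda>t. u (\<sigma> t))"
  define v where "v = (\<lambda>t. vec n (\<lambda>p. h (\<sigma> t) p / of_real (N (\<sigma> t))))"
  have \<sigma>I: "\<sigma> t \<in> I" and \<sigma>r: "\<sigma> t < r" if "t < card I" for t
    using bij_betwE[OF \<sigma>] that I(2) by auto
  have \<sigma>inj: "\<sigma> t = \<sigma> t' \<longleftrightarrow> t = t'" if "t < card I" "t' < card I" for t t'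
    using bij_betw_imp_inj_on[OF \<sigma>] that by (auto simp: inj_on_def)
  have u'c: "u' t \<in> carrier_vec m" if "t < card I" for t
    using u \<sigma>r[OF that] by (simp add: u'_def orthonormal_family_def)
  have ou: "orthonormal_family m (card I) u'"
    using u \<sigma>r \<sigma>inj by (auto simp: orthonormal_family_def u'_def)
  have ov: "orthonormal_family n (card I) v"
    unfolding orthonormal_family_def
  proof (intro conjI allI impI)
    fix t assume "t < card I"
    show "v t \<in> carrier_vec n" by (simp add: v_def)
  next
    fix t t' assume t: "t < card I" "t' < card I"
    have "v t \<bullet>c v t' = (\<Sum>p<n. h (\<sigma> t) p * cnj (h (\<sigma> t') p)) / (of_real (N (\<sigma> t)) * of_real (N (\<sigma> t')))"
      by (simp add: cscalar_prod_sum[of _ n] v_def sum_divide_distrib)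
    also have "\<dots> = (if t = t' then 1 else 0)"
      using h[OF \<sigma>r[OF t(1)] \<sigma>r[OF t(2)]] \<sigma>inj[OF t] N Npos[OF \<sigma>I[OF t(1)]] by auto
    finally show "v t \<bullet>c v t' = (if t = t' then 1 else 0)" .
  qed
  have "\<xi> = finsum_vec TYPE(complex) (m * n)
           (\<lambda>i. complex_of_real (c i) \<cdot>\<^sub>v kron_vec (u' i) (v i)) {..<card I}" (is "_ = ?S")
  proof (rule eq_vecI)
    have S: "?S \<in> carrier_vec (m * n)"
      by (rule finsum_vec_closed) (auto simp: kron_vec_def v_def dest!: u'c carrier_vecD)
    then show "dim_vec \<xi> = dim_vec ?S" using \<xi> by simp
    fix x assume "x < dim_vec ?S"
    then have x: "x < m * n" using S by simp
    then obtain a p where ap: "a < m" "p < n" "x = a * n + p" by (rule tensor_index_cases)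
    have "?S $ x = (\<Sum>t<card I. (complex_of_real (c t) \<cdot>\<^sub>v kron_vec (u' t) (v t)) $ x)"
      by (rule index_finsum_vec) (use x in \<open>auto simp: kron_vec_def v_def dest!: u'c carrier_vecD\<close>)
    also have "\<dots> = (\<Sum>t<card I. u (\<sigma> t) $ a * h (\<sigma> t) p)"
    proof (intro sum.cong refl)
      fix t assume "t \<in> {..<card I}"
      then have t: "t < card I" by simp
      show "(complex_of_real (c t) \<cdot>\<^sub>v kron_vec (u' t) (v t)) $ x = u (\<sigma> t) $ a * h (\<sigma> t) p"
        using Npos[OF \<sigma>I[OF t]] carrier_vecD[OF u'c[OF t]] ap x
        by (simp add: kron_vec_def c_def v_def) (simp add: u'_def)
    qed
    also have "\<dots> = (\<Sum>i\<in>I. u i $ a * h i p)"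
      by (rule sum.reindex_bij_betw[OF \<sigma>])
    also have "\<dots> = (\<Sum>i<r. u i $ a * h i p)"
      using ap by (intro sum.mono_neutral_left) (auto simp: I_def)
    also have "\<dots> = \<xi> $ x" using expand ap by simp
    finally show "\<xi> $ x = ?S $ x" by simp
  qed
  moreover have "0 \<le> c t" for t by (simp add: c_def N_def sum_nonneg)
  ultimately have "schmidt_decomposition m n \<xi> (card I) c u' v"
    using ou ov by (simp only: schmidt_decomposition_def) simp
  moreover have "card I \<le> r" using card_mono[OF _ I(2)] by simp
  ultimately show ?thesis by (rule that)
qed

text \<open>
  The singular value decomposition of a matrix with the two rows \<open>f\<close> and \<open>g\<close>: a unitary of
  \<open>\<complex>\<^sup>2\<close> mixes them into orthogonal rows. With \<open>h = \<langle>g, f\<rangle>\<close> and \<open>F\<close>, \<open>G\<close> the squared lengths, the quotient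
  \<open>z = cnj \<beta> / cnj \<alpha>\<close> has to solve \<open>h + (G - F) z - cnj h \<cdot> z\<^sup>2 = 0\<close>. The ansatz \<open>z = t h\<close> with \<open>t\<close> real turns
  this into \<open>1 + (G - F) t - \<bar>h\<bar>\<^sup>2 t\<^sup>2 = 0\<close>, which has positive discriminant unless \<open>h = 0\<close>.
\<close>

lemma orthogonalising_rotation:
  fixes f g :: "nat \<Rightarrow> complex"
  obtains \<alpha> \<beta> :: complex where "\<alpha> * cnj \<alpha> + \<beta> * cnj \<beta> = 1"
    and "(\<Sum>p<n. (cnj \<alpha> * f p + cnj \<beta> * g p) * cnj (\<alpha> * g p - \<beta> * f p)) = 0"
proof -
  define F G where "F = (\<Sum>p<n. (cmod (f p))\<^sup>2)" and "G = (\<Sum>p<n. (cmod (g p))\<^sup>2)"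
  define h where "h = (\<Sum>p<n. f p * cnj (g p))"
  have FG: "(\<Sum>p<n. f p * cnj (f p)) = of_real F" "(\<Sum>p<n. g p * cnj (g p)) = of_real G"
    unfolding F_def G_def of_real_sum complex_norm_square by (rule refl)+
  have h': "(\<Sum>p<n. g p * cnj (f p)) = cnj h" by (simp add: h_def mult.commute)
  have expand: "(\<Sum>p<n. (cnj \<alpha> * f p + cnj \<beta> * g p) * cnj (\<alpha> * g p - \<beta> * f p))
      = cnj \<alpha> * cnj \<alpha> * h - cnj \<alpha> * cnj \<beta> * of_real F + cnj \<alpha> * cnj \<beta> * of_real G - cnj \<beta> * cnj \<beta> * cnj h" for \<alpha> \<beta>
  proof -
    have "(\<Sum>p<n. (cnj \<alpha> * f p + cnj \<beta> * g p) * cnj (\<alpha> * g p - \<beta> * f p))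
      = (\<Sum>p<n. cnj \<alpha> * cnj \<alpha> * (f p * cnj (g p)) - cnj \<alpha> * cnj \<beta> * (f p * cnj (f p))
          + cnj \<alpha> * cnj \<beta> * (g p * cnj (g p)) - cnj \<beta> * cnj \<beta> * (g p * cnj (f p)))"
      by (intro sum.cong refl) (simp add: algebra_simps)
    also have "\<dots> = cnj \<alpha> * cnj \<alpha> * h - cnj \<alpha> * cnj \<beta> * of_real F + cnj \<alpha> * cnj \<beta> * of_real G - cnj \<beta> * cnj \<beta> * cnj h"
      by (simp only: sum.distrib sum_subtractf sum_distrib_left[symmetric] FG h') (simp add: h_def)
    finally show ?thesis .
  qed
  obtain t :: real where t: "h * (1 + (G - F) * t - (cmod h)\<^sup>2 * t\<^sup>2) = 0"
  proof (cases "h = 0")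
    case True then show ?thesis using that by simp
  next
    case False
    define H where "H = (cmod h)\<^sup>2"
    have H: "H > 0" using False by (simp add: H_def)
    define D where "D = sqrt ((G - F)\<^sup>2 + 4 * H)"
    have D: "D\<^sup>2 = (G - F)\<^sup>2 + 4 * H" using H by (simp add: D_def)
    define t where "t = ((G - F) + D) / (2 * H)"
    have "4 * H * (1 + (G - F) * t - H * t\<^sup>2) = 4 * H + 2 * (G - F) * (G - F + D) - (G - F + D)\<^sup>2"
      using H by (simp add: t_def field_simps power2_eq_square)
    also have "\<dots> = 0" using D by (simp add: power2_eq_square algebra_simps)
    finally have "1 + (G - F) * t - H * t\<^sup>2 = 0" using H by simp
    then have "complex_of_real (1 + (G - F) * t - H * t\<^sup>2) = 0" by simp
    then show ?thesis using that[of t] by (simp add: H_def)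
  qed
  define z where "z = h * of_real t"
  define M where "M = sqrt (1 + (cmod z)\<^sup>2)"
  have M: "of_real M * of_real M = (1 + z * cnj z :: complex)" "M \<noteq> 0"
  proof -
    have "1 + (cmod z)\<^sup>2 > 0" by (simp add: add_pos_nonneg)
    then show "M \<noteq> 0" by (simp add: M_def)
    have "of_real M * of_real M = (of_real (1 + (cmod z)\<^sup>2) :: complex)"
      unfolding M_def of_real_mult[symmetric] by simp
    also have "\<dots> = 1 + z * cnj z" by (simp only: of_real_add of_real_1 complex_norm_square)
    finally show "of_real M * of_real M = (1 + z * cnj z :: complex)" .
  qed
  show ?thesis
  proof
    show "1 / of_real M * cnj (1 / of_real M) + cnj z / of_real M * cnj (cnj z / of_real M) = 1"
    proof -
      have "1 + z * cnj z \<noteq> 0" unfolding M(1)[symmetric] using M(2) by simp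
      then show ?thesis using M by (simp add: add_divide_distrib[symmetric] mult.commute)
    qed
    have "h - z * of_real F + z * of_real G - z * z * cnj h
        = h * (1 + (of_real G - of_real F) * of_real t - (h * cnj h) * (of_real t)\<^sup>2)"
      by (simp add: z_def algebra_simps power2_eq_square)
    also have "\<dots> = 0"
      using t unfolding complex_norm_square[symmetric] by simp
    finally have "(h - z * of_real F + z * of_real G - z * z * cnj h) / (of_real M * of_real M) = 0" by simp
    then show "(\<Sum>p<n. (cnj (1 / of_real M) * f p + cnj (cnj z / of_real M) * g p)
        * cnj (1 / of_real M * g p - cnj z / of_real M * f p)) = 0"
      unfolding expand by (simp add: diff_divide_distrib add_divide_distrib)
  qed
qed

text \<open>
  A vector supported on \<open>\<complex>\<^sup>2 \<otimes> \<complex>\<^sup>n\<close> is \<open>e\<^sub>0 \<otimes> f + e\<^sub>1 \<otimes> g\<close>, and rotating \<open>e\<^sub>0, e\<^sub>1\<close> makes the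
  partners orthogonal.
\<close>

lemma schmidt_decomposition_two_rows:
  assumes \<xi>: "\<xi> \<in> carrier_vec (m * n)" and m: "2 \<le> m"
    and rows: "\<And>a p. 2 \<le> a \<Longrightarrow> a < m \<Longrightarrow> p < n \<Longrightarrow> \<xi> $ (a * n + p) = 0"
  obtains s c u v where "schmidt_decomposition m n \<xi> s c u v" "s \<le> 2"
proof -
  define f g where "f = (\<lambda>p. \<xi> $ p)" and "g = (\<lambda>p. \<xi> $ (n + p))"
  obtain \<alpha> \<beta> :: complex where unit: "\<alpha> * cnj \<alpha> + \<beta> * cnj \<beta> = 1"
    and orth: "(\<Sum>p<n. (cnj \<alpha> * f p + cnj \<beta> * g p) * cnj (\<alpha> * g p - \<beta> * f p)) = 0"
    by (rule orthogonalising_rotation)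
  define U :: "nat \<Rightarrow> nat \<Rightarrow> complex" where
    "U = (\<lambda>i a. if i = 0 then (if a = 0 then \<alpha> else if a = 1 then \<beta> else 0)
                else (if a = 0 then - cnj \<beta> else if a = 1 then cnj \<alpha> else 0))"
  define h :: "nat \<Rightarrow> nat \<Rightarrow> complex" where
    "h = (\<lambda>i p. if i = 0 then cnj \<alpha> * f p + cnj \<beta> * g p else \<alpha> * g p - \<beta> * f p)"
  have idx: "i = 0 \<or> i = 1" if "i < 2" for i :: nat using that by auto
  show ?thesis
  proof (rule schmidt_decomposition_of_orthogonal[OF \<xi>, of 2 "\<lambda>i. vec m (U i)" h])
    show "orthonormal_family m 2 (\<lambda>i. vec m (U i))"
      unfolding orthonormal_family_def
    proof (intro conjI allI impI)
      fix i j :: nat assume ij: "i < 2" "j < 2"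
      have "vec m (U i) \<bullet>c vec m (U j) = (\<Sum>a<m. U i a * cnj (U j a))"
        by (simp add: cscalar_prod_sum[of _ m])
      also have "\<dots> = (\<Sum>a<2. U i a * cnj (U j a))"
        using m by (intro sum.mono_neutral_right) (auto simp: U_def)
      also have "\<dots> = (if i = j then 1 else 0)"
        using idx[OF ij(1)] idx[OF ij(2)] unit by (auto simp: sum_two U_def ac_simps)
      finally show "vec m (U i) \<bullet>c vec m (U j) = (if i = j then 1 else 0)" .
    qed simp
    have orth': "(\<Sum>p<n. (\<alpha> * g p - \<beta> * f p) * cnj (cnj \<alpha> * f p + cnj \<beta> * g p)) = 0"
      using arg_cong[OF orth, of cnj] by (simp add: mult.commute)
    show "(\<Sum>p<n. h i p * cnj (h j p)) = 0" if "i < 2" "j < 2" "i \<noteq> j" for i j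
      using idx[OF that(1)] idx[OF that(2)] that(3) orth orth' unfolding h_def by (elim disjE) simp_all
    show "\<xi> $ (a * n + p) = (\<Sum>i<2. vec m (U i) $ a * h i p)" if "a < m" "p < n" for a p
    proof -
      consider "a = 0" | "a = 1" | "2 \<le> a" by linarith
      then show ?thesis
      proof cases
        case 1
        have "\<alpha> * (cnj \<alpha> * f p + cnj \<beta> * g p) - cnj \<beta> * (\<alpha> * g p - \<beta> * f p)
            = (\<alpha> * cnj \<alpha> + \<beta> * cnj \<beta>) * f p"
          by (simp add: algebra_simps)
        also have "\<dots> = f p" by (simp add: unit)
        finally have "\<alpha> * (cnj \<alpha> * f p + cnj \<beta> * g p) - cnj \<beta> * (\<alpha> * g p - \<beta> * f p) = f p" .
        then show ?thesis using 1 that by (simp add: sum_two U_def h_def f_def)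
      next
        case 2
        have "\<beta> * (cnj \<alpha> * f p + cnj \<beta> * g p) + cnj \<alpha> * (\<alpha> * g p - \<beta> * f p)
            = (\<alpha> * cnj \<alpha> + \<beta> * cnj \<beta>) * g p"
          by (simp add: algebra_simps)
        also have "\<dots> = g p" by (simp add: unit)
        finally have "\<beta> * (cnj \<alpha> * f p + cnj \<beta> * g p) + cnj \<alpha> * (\<alpha> * g p - \<beta> * f p) = g p" .
        then show ?thesis using 2 that by (simp add: sum_two U_def h_def g_def)
      next
        case 3
        then show ?thesis using that rows by (simp add: sum_two U_def)
      qed
    qed
  qed (rule that)
qed

lemma ketbra_carrier: "v \<in> carrier_vec n \<Longrightarrow> ketbra v \<in> carrier_mat n n"
  by (auto simp: ketbra_def)

lemma rank_one_decomposition_index: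
  assumes "rank_one_decomposition n X N \<xi>" "x < n" "y < n"
  shows "X $$ (x, y) = (\<Sum>k<N. \<xi> k $ x * cnj (\<xi> k $ y))"
proof -
  have \<xi>: "\<And>k. k < N \<Longrightarrow> \<xi> k \<in> carrier_vec n"
    and X: "X = finsum (module_mat TYPE(complex) n n) (\<lambda>i. ketbra (\<xi> i)) {..<N}"
    using assms(1) by (auto simp: rank_one_decomposition_def)
  have "X $$ (x, y) = (\<Sum>k<N. ketbra (\<xi> k) $$ (x, y))"
    unfolding X by (rule finsum_mat_index) (use \<xi> assms(2,3) in \<open>auto intro: ketbra_carrier\<close>)
  also have "\<dots> = (\<Sum>k<N. \<xi> k $ x * cnj (\<xi> k $ y))"
    by (intro sum.cong refl) (use \<xi>[THEN carrier_vecD] assms(2,3) in \<open>simp add: ketbra_def\<close>)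
  finally show ?thesis .
qed

text \<open>
  A diagonal entry of \<open>\<Sum> |\<xi>\<rangle>\<langle>\<xi>|\<close> is a sum of squared moduli. Hence every vector in every decomposition of
  \<open>X\<close> is supported where the diagonal of \<open>X\<close> is nonzero.
\<close>

lemma rank_one_decomposition_vanish:
  assumes dec: "rank_one_decomposition n X N \<xi>" and x: "x < n" "X $$ (x, x) = 0" and k: "k < N"
  shows "\<xi> k $ x = 0"
proof -
  have "(\<Sum>k<N. \<xi> k $ x * cnj (\<xi> k $ x)) = 0"
    using rank_one_decomposition_index[OF dec x(1) x(1)] x(2) by simp
  moreover have "0 \<le> \<xi> k $ x * cnj (\<xi> k $ x)" for k by (rule mult_cnj_self_nonneg)
  ultimately have "\<xi> k $ x * cnj (\<xi> k $ x) = 0" using k by (simp add: sum_nonneg_eq_0_iff)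
  then show ?thesis by simp
qed

lemma schmidt_rank_le:
  assumes "schmidt_decomposition m n \<xi> r c u v"
  shows "schmidt_rank m n \<xi> \<le> r"
proof -
  have "schmidt_rank m n \<xi> \<le> card {i. i < r \<and> c i \<noteq> 0}"
    unfolding schmidt_rank_def by (rule Least_le) (use assms in blast)
  also have "\<dots> \<le> card {..<r}" by (rule card_mono) auto
  finally show ?thesis by simp
qed

text \<open>
  The Schmidt rank is a least element, so its value carries information only when some Schmidt
  decomposition is known to exist; this is the role of \<open>dec\<close>.
\<close>

lemma product_vector_of_schmidt_rank_le_1:
  assumes dec: "schmidt_decomposition m n \<xi> r c u v" and rank: "schmidt_rank m n \<xi> \<le> 1"
  obtains s t where "\<And>a p. a < m \<Longrightarrow> p < n \<Longrightarrow> \<xi> $ (a * n + p) = s a * t p"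
proof -
  have "\<exists>r c u v. schmidt_decomposition m n \<xi> r c u v \<and> schmidt_rank m n \<xi> = card {i. i < r \<and> c i \<noteq> 0}"
    unfolding schmidt_rank_def by (rule LeastI_ex) (use dec in blast)
  then obtain r c u v where dec: "schmidt_decomposition m n \<xi> r c u v"
    and card: "card {i. i < r \<and> c i \<noteq> 0} \<le> 1"
    using rank by auto
  have \<xi>: "\<xi> $ (a * n + p) = (\<Sum>i\<in>{i. i < r \<and> c i \<noteq> 0}. of_real (c i) * (u i $ a * v i $ p))"
    if "a < m" "p < n" for a p
    unfolding schmidt_decomposition_index[OF dec that] by (rule sum.mono_neutral_right) auto
  show ?thesis
  proof (cases "{i. i < r \<and> c i \<noteq> 0} = {}")
    case True
    show ?thesis by (rule that[of "\<lambda>_. 0" "\<lambda>_. 0"]) (use \<xi> True in simp)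
  next
    case False
    then have "card {i. i < r \<and> c i \<noteq> 0} = 1" using card by (simp add: card_gt_0_iff Suc_le_eq le_antisym)
    then obtain i where "{i. i < r \<and> c i \<noteq> 0} = {i}" by (auto simp: card_1_singleton_iff)
    then show ?thesis
      by (intro that[of "\<lambda>a. of_real (c i) * u i $ a" "\<lambda>p. v i $ p"]) (use \<xi> in \<open>simp add: mult.assoc\<close>)
  qed
qed

text \<open>
  If only the first two levels of the input space occur, all vectors in all decompositions of the Choi
  matrix live on \<open>\<complex>\<^sup>2 \<otimes> \<complex>\<^sup>d\<close> and have Schmidt rank at most two. A decomposition with all ranks at most
  one would consist of product vectors, which \<open>entangled\<close> excludes. Nonzero \<open>w l\<close> are demanded because
  the vectors \<open>w l\<close> themselves serve as a decomposition, whose members have to be nonzero.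
\<close>

lemma schmidt_number_kraus_map_eq_2:
  assumes d: "2 \<le> d" and rows: "\<And>l i p. 2 \<le> i \<Longrightarrow> w l i p = 0"
    and nonzero: "\<And>l. l < N \<Longrightarrow> \<exists>i<d. \<exists>p<d. w l i p \<noteq> 0"
    and entangled: "\<And>(M :: nat) s t.
      (\<And>i j p q. i < 2 \<Longrightarrow> j < 2 \<Longrightarrow> p < d \<Longrightarrow> q < d \<Longrightarrow>
        (\<Sum>l<N. w l i p * cnj (w l j q)) = (\<Sum>k<M. s k i * cnj (s k j) * (t k p * cnj (t k q)))) \<Longrightarrow> False"
  shows "schmidt_number_map d (kraus_map d N w) = 2"
proof -
  define X where "X = choi_matrix d (kraus_map d N w)"
  note X = choi_kraus_map[where d = d and N = N and w = w, folded X_def]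
  have ranks: "schmidt_rank d d (\<zeta> k) \<le> 2" "\<exists>r c u v. schmidt_decomposition d d (\<zeta> k) r c u v"
    if dec: "rank_one_decomposition (d * d) X M \<zeta>" and k: "k < M" for M \<zeta> k
  proof -
    have "\<zeta> k \<in> carrier_vec (d * d)" using that by (simp add: rank_one_decomposition_def)
    moreover have "\<zeta> k $ (a * d + p) = 0" if "2 \<le> a" "a < d" "p < d" for a p
      by (rule rank_one_decomposition_vanish[OF dec _ _ k])
        (use that in \<open>simp_all add: tensor_index_less X(2) rows\<close>)
    ultimately obtain r c u v where "schmidt_decomposition d d (\<zeta> k) r c u v" "r \<le> 2"
      using schmidt_decomposition_two_rows[of "\<zeta> k" d d] d by metis
    then show "schmidt_rank d d (\<zeta> k) \<le> 2" "\<exists>r c u v. schmidt_decomposition d d (\<zeta> k) r c u v"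
      using schmidt_rank_le by (blast intro: order_trans)+
  qed
  have lower: "2 \<le> Max (insert 0 ((\<lambda>k. schmidt_rank d d (\<zeta> k)) ` {..<M}))"
    if dec: "rank_one_decomposition (d * d) X M \<zeta>" for M \<zeta>
  proof (rule ccontr)
    assume small: "\<not> ?thesis"
    have "schmidt_rank d d (\<zeta> k) \<le> 1" if "k < M" for k
    proof -
      have "schmidt_rank d d (\<zeta> k) \<le> Max (insert 0 ((\<lambda>k. schmidt_rank d d (\<zeta> k)) ` {..<M}))"
        using that by (intro Max_ge) auto
      then show ?thesis using small by linarith
    qed
    then have "\<exists>s t. \<forall>a p. a < d \<longrightarrow> p < d \<longrightarrow> \<zeta> k $ (a * d + p) = s a * t p" if "k < M" for k
      using ranks(2)[OF dec that] that product_vector_of_schmidt_rank_le_1 by metis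
    then obtain s t where st: "\<And>k a p. k < M \<Longrightarrow> a < d \<Longrightarrow> p < d \<Longrightarrow> \<zeta> k $ (a * d + p) = s k a * t k p"
      by metis
    show False
    proof (rule entangled)
      fix i j p q assume lt: "i < (2::nat)" "j < (2::nat)" "p < d" "q < d"
      then have lt': "i < d" "j < d" using d by auto
      have "(\<Sum>l<N. w l i p * cnj (w l j q)) = X $$ (i * d + p, j * d + q)"
        using X(2) lt lt' by simp
      also have "\<dots> = (\<Sum>k<M. \<zeta> k $ (i * d + p) * cnj (\<zeta> k $ (j * d + q)))"
        using rank_one_decomposition_index[OF dec] lt lt' by (simp add: tensor_index_less)
      also have "\<dots> = (\<Sum>k<M. s k i * cnj (s k j) * (t k p * cnj (t k q)))"
        using st lt lt' by (intro sum.cong refl) simp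
      finally show "(\<Sum>l<N. w l i p * cnj (w l j q)) = (\<Sum>k<M. s k i * cnj (s k j) * (t k p * cnj (t k q)))" .
    qed
  qed
  define \<xi> where "\<xi> = (\<lambda>l. vec (d * d) (\<lambda>x. w l (x div d) (x mod d)))"
  have \<xi>: "\<xi> l \<in> carrier_vec (d * d)" for l by (simp add: \<xi>_def)
  have \<xi>i: "\<xi> l $ (i * d + p) = w l i p" if "i < d" "p < d" for l i p
    using that by (simp add: \<xi>_def tensor_index_less)
  have dec: "rank_one_decomposition (d * d) X N \<xi>"
    unfolding rank_one_decomposition_def
  proof (intro conjI allI impI)
    show "\<xi> l \<in> carrier_vec (d * d)" for l by (rule \<xi>)
    show "\<xi> l \<noteq> 0\<^sub>v (d * d)" if "l < N" for l
      using nonzero[OF that] \<xi>i by (metis index_zero_vec(1) tensor_index_less)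
    show "X = finsum (module_mat TYPE(complex) (d * d) (d * d)) (\<lambda>l. ketbra (\<xi> l)) {..<N}" (is "_ = ?S")
    proof (rule tensor_mat_eqI)
      show "X \<in> carrier_mat (d * d) (d * d)" by (rule X(1))
      show "?S \<in> carrier_mat (d * d) (d * d)"
        by (rule finsum_mat_carrier) (auto intro: ketbra_carrier \<xi>)
      fix i p j q assume lt: "i < d" "p < d" "j < d" "q < d"
      have "?S $$ (i * d + p, j * d + q) = (\<Sum>l<N. ketbra (\<xi> l) $$ (i * d + p, j * d + q))"
        by (rule finsum_mat_index) (use lt in \<open>auto intro: ketbra_carrier \<xi> tensor_index_less\<close>)
      also have "\<dots> = (\<Sum>l<N. w l i p * cnj (w l j q))"
        using lt \<xi>i carrier_vecD[OF \<xi>] by (intro sum.cong refl) (simp add: ketbra_def tensor_index_less)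
      finally show "X $$ (i * d + p, j * d + q) = ?S $$ (i * d + p, j * d + q)" using X(2) lt by simp
    qed
  qed
  have "Max (insert 0 ((\<lambda>k. schmidt_rank d d (\<xi> k)) ` {..<N})) \<le> 2"
    using ranks(1)[OF dec] by auto
  with lower[OF dec] have "Max (insert 0 ((\<lambda>k. schmidt_rank d d (\<xi> k)) ` {..<N})) = 2" by simp
  then show ?thesis
    unfolding schmidt_number_map_def schmidt_number_def X_def[symmetric]
    using dec lower by (intro Least_equality) (metis, blast)
qed

section \<open>The range criterion\<close>

text \<open>
  Horodecki's range criterion. The vector \<open>\<psi>\<close> is in the kernel of \<open>\<rho> = \<Sum> |w l\<rangle>\<langle>w l|\<close>. If \<open>\<rho>\<close> is also
  \<open>\<Sum> |e k\<rangle>\<langle>e k| \<otimes> B k\<close>, then \<open>0 = \<langle>\<psi>, \<rho> \<psi>\<rangle>\<close> is the sum of the nonnegative numbers \<open>\<langle>y k, B k (y k)\<rangle>\<close> with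
  \<open>y k = (\<langle>e k| \<otimes> 1) \<psi>\<close>. So each of them is zero, and \<open>y k\<close> is in the kernel of \<open>B k\<close>.
\<close>

lemma range_criterion:
  fixes w :: "nat \<Rightarrow> nat \<Rightarrow> nat \<Rightarrow> complex" and e :: "'k \<Rightarrow> nat \<Rightarrow> complex"
  assumes K: "finite K" and B: "\<And>k. k \<in> K \<Longrightarrow> B k \<in> psd n"
    and decomp: "\<And>i j p q. i < m \<Longrightarrow> j < m \<Longrightarrow> p < n \<Longrightarrow> q < n \<Longrightarrow>
      (\<Sum>l<N. w l i p * cnj (w l j q)) = (\<Sum>k\<in>K. e k i * cnj (e k j) * B k $$ (p, q))"
    and orth: "\<And>l. l < N \<Longrightarrow> (\<Sum>p<n. \<Sum>i<m. cnj (\<psi> i p) * w l i p) = 0"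
    and k: "k \<in> K" and r: "r < n"
  shows "(\<Sum>q<n. B k $$ (r, q) * (\<Sum>j<m. cnj (e k j) * \<psi> j q)) = 0"
proof -
  define y where "y = (\<lambda>k q. \<Sum>j<m. cnj (e k j) * \<psi> j q)"
  define Q where "Q = (\<lambda>k. \<Sum>p<n. \<Sum>q<n. cnj (y k p) * B k $$ (p, q) * y k q)"
  have "(\<Sum>k\<in>K. Q k)
      = (\<Sum>k\<in>K. \<Sum>p<n. \<Sum>q<n. \<Sum>i<m. \<Sum>j<m. cnj (\<psi> i p) * (e k i * cnj (e k j) * B k $$ (p, q)) * \<psi> j q)"
    unfolding Q_def y_def
    by (simp add: sum_product sum_distrib_left sum_distrib_right ac_simps)
  also have "\<dots> = (\<Sum>p<n. \<Sum>q<n. \<Sum>i<m. \<Sum>j<m. cnj (\<psi> i p) * (\<Sum>k\<in>K. e k i * cnj (e k j) * B k $$ (p, q)) * \<psi> j q)"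
    by (simp add: sum.swap[of _ _ K] sum_distrib_left sum_distrib_right)
  also have "\<dots> = (\<Sum>p<n. \<Sum>q<n. \<Sum>i<m. \<Sum>j<m. cnj (\<psi> i p) * (\<Sum>l<N. w l i p * cnj (w l j q)) * \<psi> j q)"
    by (intro sum.cong refl) (simp add: decomp)
  also have "\<dots> = (\<Sum>l<N. \<Sum>p<n. \<Sum>q<n. \<Sum>i<m. \<Sum>j<m. cnj (\<psi> i p) * (w l i p * cnj (w l j q)) * \<psi> j q)"
    by (simp add: sum.swap[of _ _ "{..<N}"] sum_distrib_left sum_distrib_right)
  also have "\<dots> = (\<Sum>l<N. (\<Sum>p<n. \<Sum>i<m. cnj (\<psi> i p) * w l i p) * cnj (\<Sum>p<n. \<Sum>i<m. cnj (\<psi> i p) * w l i p))"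
    by (simp only: cnj_sum sum_product) (simp add: ac_simps)
  also have "\<dots> = 0" by (simp add: orth)
  finally have "(\<Sum>k\<in>K. Q k) = 0" .
  moreover have "0 \<le> Q k" if "k \<in> K" for k
    unfolding Q_def by (rule psd_form_nonneg[OF B[OF that]])
  ultimately have "Q k = 0" using K k by (simp add: sum_nonneg_eq_0_iff)
  then show ?thesis using psd_kernel[OF B[OF k], of "y k" r] r by (simp add: Q_def y_def)
qed

section \<open>An entangled state with positive partial transpose\<close>

text \<open>
  The five vectors \<open>4(|00\<rangle> + |11\<rangle>)\<close>, \<open>4(|01\<rangle> + |12\<rangle>)\<close>, \<open>4(|02\<rangle> + |13\<rangle>)\<close>, \<open>4|03\<rangle>\<close> and \<open>5|10\<rangle> + 3|13\<rangle>\<close>, padded by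
  zeros. The sum of their projections is a member of Horodecki's family of states on \<open>\<complex>\<^sup>2 \<otimes> \<complex>\<^sup>4\<close>. The
  coefficients are chosen with \<open>3\<^sup>2 + 4\<^sup>2 = 5\<^sup>2\<close>, which makes the state and its partial transpose mirror
  images of each other.
\<close>

definition edge_ket :: "nat \<Rightarrow> nat \<Rightarrow> nat \<Rightarrow> complex" where
  "edge_ket l i p =
     (if i = 0 \<and> p = l \<and> l < 4 \<or> i = 1 \<and> p = Suc l \<and> l < 3 then 4
      else if l = 4 \<and> i = 1 \<and> p = 0 then 5
      else if l = 4 \<and> i = 1 \<and> p = 3 then 3 else 0)"

definition flipped_ket :: "nat \<Rightarrow> nat \<Rightarrow> nat \<Rightarrow> complex" where
  "flipped_ket l i p = (if p < 4 then edge_ket l i (3 - p) else 0)"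

lemma ket_support:
  "edge_ket l i p \<noteq> 0 \<Longrightarrow> i < 2 \<and> p < 4" "flipped_ket l i p \<noteq> 0 \<Longrightarrow> i < 2 \<and> p < 4"
  by (auto simp: edge_ket_def flipped_ket_def split: if_splits)

lemma cnj_ket: "cnj (edge_ket l i p) = edge_ket l i p" "cnj (flipped_ket l i p) = flipped_ket l i p"
  by (auto simp: edge_ket_def flipped_ket_def)

lemma less_4_iff_cases: "p < 4 \<longleftrightarrow> p = 0 \<or> p = 1 \<or> p = 2 \<or> p = 3" for p :: nat
  by auto

lemma less_2_iff_cases: "p < 2 \<longleftrightarrow> p = 0 \<or> p = 1" for p :: nat
  by auto

lemma sum_five: "(\<Sum>l<5. f l) = f 0 + f 1 + f 2 + f 3 + f 4" for f :: "nat \<Rightarrow> complex"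
  by (simp add: eval_nat_numeral)

text \<open>
  The projections onto the flipped vectors add up to the partial transpose, in the first factor, of the
  original state. On \<open>|10\<rangle>\<close> and \<open>|13\<rangle>\<close> this needs \<open>25\<close> and \<open>16 + 9\<close> to be exchanged by the reversal; the
  off-diagonal entry there is \<open>15\<close> in both.
\<close>

lemma flipped_ket_partial_transpose:
  "(\<Sum>l<5. flipped_ket l i p * cnj (flipped_ket l j q)) = (\<Sum>l<5. edge_ket l j p * cnj (edge_ket l i q))"
proof (cases "i < 2 \<and> j < 2 \<and> p < 4 \<and> q < 4")
  case True
  then show ?thesis
    unfolding less_2_iff_cases less_4_iff_cases
    by (elim conjE disjE) (simp_all add: sum_five edge_ket_def flipped_ket_def)
next
  case False
  then show ?thesis
    by (intro sum.cong refl) (metis ket_support complex_cnj_zero_iff mult_eq_0_iff)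
qed


lemma sum_truncate:
  fixes f :: "nat \<Rightarrow> complex"
  assumes "4 \<le> d" and "\<And>p. 4 \<le> p \<Longrightarrow> f p = 0"
  shows "(\<Sum>p<d. f p) = f 0 + f 1 + f 2 + f 3"
proof -
  have "(\<Sum>p<d. f p) = (\<Sum>p<4. f p)"
    using assms by (intro sum.mono_neutral_right) auto
  then show ?thesis by (simp add: eval_nat_numeral)
qed

text \<open>
  Here \<open>(x, y)\<close> is the first factor \<open>e\<close> of a term \<open>|e\<rangle>\<langle>e| \<otimes> B\<close>, and \<open>b0, \<dots>, b3\<close> are the entries of a row of \<open>B\<close>.
  The first three equations come from the kernel of the state and the other three from the kernel of
  its partial transpose. If \<open>x\<close> and \<open>y\<close> are both nonzero, the second and fifth equations give
  \<open>\<bar>x\<bar> = \<bar>y\<bar>\<close>. Then the first one reads \<open>x b1 = y b0\<close>, the sixth leaves \<open>b3 = 0\<close>, and the fourth, fifth and first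
  propagate this to \<open>b2\<close>, \<open>b1\<close> and \<open>b0\<close>. For \<open>y = 0\<close> the first equation suffices, and
  \<open>x = 0\<close> leaves \<open>5 b3 = 3 b0\<close> and \<open>5 b0 = 3 b3\<close>.
\<close>

lemma edge_kernel_product:
  fixes x y b0 b1 b2 b3 :: complex
  assumes "cnj x * b0 = cnj y * b1" "cnj x * b1 = cnj y * b2" "5 * (cnj x * b2) = 5 * (cnj y * b3) - 3 * (cnj y * b0)"
    and "x * b3 = y * b2" "x * b2 = y * b1" "5 * (x * b1) = 5 * (y * b0) - 3 * (y * b3)"
    and "x \<noteq> 0 \<or> y \<noteq> 0"
  shows "b0 = 0"
proof (cases "x = 0")
  case True
  then have a: "5 * b3 = 3 * b0" and b: "5 * b0 = 3 * b3" using assms by auto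
  have "25 * b0 = 5 * (5 * b0)" by simp
  also have "\<dots> = 3 * (5 * b3)" unfolding b by simp
  also have "\<dots> = 9 * b0" unfolding a by simp
  finally show ?thesis by simp
next
  case x: False
  show ?thesis
  proof (cases "y = 0")
    case True
    with assms x show ?thesis by simp
  next
    case y: False
    show ?thesis
    proof (rule ccontr)
      assume b0: "b0 \<noteq> 0"
      have xx: "cnj x \<noteq> 0" and yy: "cnj y \<noteq> 0" using x y by auto
      with assms b0 have b: "b1 \<noteq> 0" "b2 \<noteq> 0" by auto
      have "x * cnj x * b1 = x * (cnj x * b1)" by (simp only: mult.assoc)
      also have "\<dots> = cnj y * (x * b2)" unfolding assms(2) by (rule mult.left_commute)
      also have "\<dots> = y * cnj y * b1" unfolding assms(5) by (simp only: ac_simps)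
      finally have "x * cnj x * b1 = y * cnj y * b1" .
      then have n: "x * cnj x = y * cnj y" using b by simp
      have "cnj y * (x * b1) = x * (cnj x * b0)" unfolding assms(1) by (rule mult.left_commute)
      also have "\<dots> = x * cnj x * b0" by (simp only: mult.assoc)
      also have "\<dots> = cnj y * (y * b0)" unfolding n by (simp only: ac_simps)
      finally have "cnj y * (x * b1) = cnj y * (y * b0)" .
      then have "x * b1 = y * b0" using yy by simp
      then have "b3 = 0" using assms(6) y by simp
      then show False using assms(4) b y by simp
    qed
  qed
qed

text \<open>
  A term \<open>|e\<rangle>\<langle>e| \<otimes> B\<close> of the state corresponds to the term \<open>|cnj e\<rangle>\<langle>cnj e| \<otimes> B\<close> of the partial transpose, so the
  range criterion applies to both. The resulting equations force every term to vanish at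
  \<open>|00\<rangle>\<close>, where the state has the entry \<open>16\<close>.
\<close>

lemma edge_state_entangled:
  fixes e :: "'k \<Rightarrow> nat \<Rightarrow> complex"
  assumes d: "4 \<le> d" and K: "finite K" and B: "\<And>k. k \<in> K \<Longrightarrow> B k \<in> psd d"
    and decomp: "\<And>i j p q. i < 2 \<Longrightarrow> j < 2 \<Longrightarrow> p < d \<Longrightarrow> q < d \<Longrightarrow>
      (\<Sum>l<5. edge_ket l i p * cnj (edge_ket l j q)) = (\<Sum>k\<in>K. e k i * cnj (e k j) * B k $$ (p, q))"
  shows False
proof -
  have five: "l < 5 \<longleftrightarrow> l = 0 \<or> l = 1 \<or> l = 2 \<or> l = 3 \<or> l = 4" for l :: nat by auto
  have decomp': "(\<Sum>l<5. flipped_ket l i p * cnj (flipped_ket l j q))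
      = (\<Sum>k\<in>K. cnj (e k i) * cnj (cnj (e k j)) * B k $$ (p, q))"
    if "i < 2" "j < 2" "p < d" "q < d" for i j p q
    using decomp[of j i p q] that unfolding flipped_ket_partial_transpose by (simp add: ac_simps)
  have ker: "(\<Sum>q<d. B k $$ (r, q) * (\<Sum>j<2. cnj (e k j) * \<psi> j q)) = 0"
    if "\<And>l. l < 5 \<Longrightarrow> (\<Sum>p<d. \<Sum>i<2. cnj (\<psi> i p) * edge_ket l i p) = 0" "k \<in> K" "r < d" for \<psi> k r
    by (rule range_criterion[OF K B decomp that]) auto
  have ker': "(\<Sum>q<d. B k $$ (r, q) * (\<Sum>j<2. cnj (cnj (e k j)) * \<psi> j q)) = 0"
    if "\<And>l. l < 5 \<Longrightarrow> (\<Sum>p<d. \<Sum>i<2. cnj (\<psi> i p) * flipped_ket l i p) = 0" "k \<in> K" "r < d" for \<psi> k r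
    by (rule range_criterion[OF K B decomp' that]) auto
  \<comment> \<open>A basis of the kernel of the state inside the \<open>2 \<times> 4\<close> levels; its flip is one for the partial transpose.\<close>
  define \<psi>1 \<psi>2 \<psi>3 :: "nat \<Rightarrow> nat \<Rightarrow> complex"
    where "\<psi>1 = (\<lambda>i p. if i = 0 \<and> p = 0 then 1 else if i = 1 \<and> p = 1 then - 1 else 0)"
      and "\<psi>2 = (\<lambda>i p. if i = 0 \<and> p = 1 then 1 else if i = 1 \<and> p = 2 then - 1 else 0)"
      and "\<psi>3 = (\<lambda>i p. if i = 0 \<and> p = 2 then 5 else if i = 1 \<and> p = 3 then - 5
                     else if i = 1 \<and> p = 0 then 3 else 0)"
  define flip :: "(nat \<Rightarrow> nat \<Rightarrow> complex) \<Rightarrow> nat \<Rightarrow> nat \<Rightarrow> complex"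
    where "flip = (\<lambda>\<psi> i p. if p < 4 then \<psi> i (3 - p) else 0)"
  note defs = \<psi>1_def \<psi>2_def \<psi>3_def edge_ket_def flipped_ket_def flip_def
  have orth: "(\<Sum>p<d. \<Sum>i<2. cnj (\<psi> i p) * edge_ket l i p) = 0"
    if "l < 5" "\<psi> \<in> {\<psi>1, \<psi>2, \<psi>3}" for l \<psi>
  proof (subst sum_truncate[OF d])
    show "(\<Sum>i<2. cnj (\<psi> i p) * edge_ket l i p) = 0" if "4 \<le> p" for p
      using that by (auto simp: sum_two edge_ket_def)
    show "(\<Sum>i<2. cnj (\<psi> i 0) * edge_ket l i 0) + (\<Sum>i<2. cnj (\<psi> i 1) * edge_ket l i 1)
      + (\<Sum>i<2. cnj (\<psi> i 2) * edge_ket l i 2) + (\<Sum>i<2. cnj (\<psi> i 3) * edge_ket l i 3) = 0"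
      using that unfolding five by (elim disjE insertE emptyE) (simp_all add: sum_two defs)
  qed
  have orth': "(\<Sum>p<d. \<Sum>i<2. cnj (flip \<psi> i p) * flipped_ket l i p) = 0"
    if "l < 5" "\<psi> \<in> {\<psi>1, \<psi>2, \<psi>3}" for l \<psi>
  proof (subst sum_truncate[OF d])
    show "(\<Sum>i<2. cnj (flip \<psi> i p) * flipped_ket l i p) = 0" if "4 \<le> p" for p
      using that by (auto simp: sum_two flip_def)
    show "(\<Sum>i<2. cnj (flip \<psi> i 0) * flipped_ket l i 0) + (\<Sum>i<2. cnj (flip \<psi> i 1) * flipped_ket l i 1)
      + (\<Sum>i<2. cnj (flip \<psi> i 2) * flipped_ket l i 2) + (\<Sum>i<2. cnj (flip \<psi> i 3) * flipped_ket l i 3) = 0"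
      using that unfolding five by (elim disjE insertE emptyE) (simp_all add: sum_two defs)
  qed
  have vanish: "e k 0 * cnj (e k 0) * B k $$ (0, 0) = 0" if k: "k \<in> K" for k
  proof (cases "e k 0 \<noteq> 0 \<or> e k 1 \<noteq> 0")
    case True
    have 0: "0 < d" using d by simp
    have eqs: "\<And>\<psi>. \<psi> \<in> {\<psi>1, \<psi>2, \<psi>3} \<Longrightarrow>
        (\<Sum>q<d. B k $$ (0, q) * (\<Sum>j<2. cnj (e k j) * \<psi> j q)) = 0"
      "\<And>\<psi>. \<psi> \<in> {\<psi>1, \<psi>2, \<psi>3} \<Longrightarrow>
        (\<Sum>q<d. B k $$ (0, q) * (\<Sum>j<2. cnj (cnj (e k j)) * flip \<psi> j q)) = 0"
      using ker[OF orth k 0] ker'[OF orth' k 0] by blast+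
    have tr: "(\<Sum>q<d. B k $$ (0, q) * (\<Sum>j<2. c j * \<psi> j q))
      = B k $$ (0, 0) * (\<Sum>j<2. c j * \<psi> j 0) + B k $$ (0, 1) * (\<Sum>j<2. c j * \<psi> j 1)
        + B k $$ (0, 2) * (\<Sum>j<2. c j * \<psi> j 2) + B k $$ (0, 3) * (\<Sum>j<2. c j * \<psi> j 3)"
      if "\<psi> \<in> {\<psi>1, \<psi>2, \<psi>3, flip \<psi>1, flip \<psi>2, flip \<psi>3}" for c \<psi>
      by (rule sum_truncate[OF d]) (use that in \<open>auto simp: sum_two defs\<close>)
    have "B k $$ (0, 0) = 0"
    proof (rule edge_kernel_product[OF _ _ _ _ _ _ True])
      let ?b = "\<lambda>q. B k $$ (0, q)"
      show "cnj (e k 0) * ?b 0 = cnj (e k 1) * ?b 1"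
        using eqs(1)[of \<psi>1] by (simp add: tr) (simp add: sum_two \<psi>1_def algebra_simps)
      show "cnj (e k 0) * ?b 1 = cnj (e k 1) * ?b 2"
        using eqs(1)[of \<psi>2] by (simp add: tr) (simp add: sum_two \<psi>2_def algebra_simps)
      show "5 * (cnj (e k 0) * ?b 2) = 5 * (cnj (e k 1) * ?b 3) - 3 * (cnj (e k 1) * ?b 0)"
        using eqs(1)[of \<psi>3] by (simp add: tr) (simp add: sum_two \<psi>3_def algebra_simps)
      show "e k 0 * ?b 3 = e k 1 * ?b 2"
        using eqs(2)[of \<psi>1] by (simp add: tr) (simp add: sum_two \<psi>1_def flip_def algebra_simps)
      show "e k 0 * ?b 2 = e k 1 * ?b 1"
        using eqs(2)[of \<psi>2] by (simp add: tr) (simp add: sum_two \<psi>2_def flip_def algebra_simps)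
      show "5 * (e k 0 * ?b 1) = 5 * (e k 1 * ?b 0) - 3 * (e k 1 * ?b 3)"
        using eqs(2)[of \<psi>3] by (simp add: tr) (simp add: sum_two \<psi>3_def flip_def algebra_simps)
    qed
    then show ?thesis by simp
  qed simp
  have "(\<Sum>l<5. edge_ket l 0 0 * cnj (edge_ket l 0 0)) = 0"
    using decomp[of 0 0 0 0] d vanish by simp
  then show False by (simp add: sum_five edge_ket_def)
qed

lemma flipped_state_entangled:
  fixes e :: "'k \<Rightarrow> nat \<Rightarrow> complex"
  assumes d: "4 \<le> d" and K: "finite K" and B: "\<And>k. k \<in> K \<Longrightarrow> B k \<in> psd d"
    and decomp: "\<And>i j p q. i < 2 \<Longrightarrow> j < 2 \<Longrightarrow> p < d \<Longrightarrow> q < d \<Longrightarrow>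
      (\<Sum>l<5. flipped_ket l i p * cnj (flipped_ket l j q)) = (\<Sum>k\<in>K. e k i * cnj (e k j) * B k $$ (p, q))"
  shows False
proof (rule edge_state_entangled[OF d K B])
  show "(\<Sum>l<5. edge_ket l i p * cnj (edge_ket l j q))
      = (\<Sum>k\<in>K. cnj (e k i) * cnj (cnj (e k j)) * B k $$ (p, q))"
    if "i < 2" "j < 2" "p < d" "q < d" for i j p q
    using decomp[of j i p q] that unfolding flipped_ket_partial_transpose by (simp add: ac_simps)
qed

section \<open>The map\<close>

lemma product_mat_psd: "mat n n (\<lambda>(p, q). t p * cnj (t q)) \<in> psd n"
proof -
  have "ketbra (vec n t) = mat n n (\<lambda>(p, q). t p * cnj (t q))"
    by (rule eq_matI) (auto simp: ketbra_def)
  then show ?thesis using ketbra_psd[of "vec n t"] by simp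
qed

lemma schmidt_number_edge_map:
  assumes d: "4 \<le> d"
  shows "schmidt_number_map d (kraus_map d 5 edge_ket) = 2"
    and "schmidt_number_map d (kraus_map d 5 flipped_ket) = 2"
proof -
  have d2: "2 \<le> d" using d by simp
  have nz: "\<exists>i<2. \<exists>p<4. edge_ket l i p \<noteq> 0" if "l < 5" for l
  proof (cases "l = 4")
    case True
    then have "edge_ket l 1 0 \<noteq> 0" by (simp add: edge_ket_def)
    then show ?thesis by (intro exI[of _ 1] conjI exI[of _ 0]) simp_all
  next
    case False
    then have "l < 4" "edge_ket l 0 l \<noteq> 0" using that by (simp_all add: edge_ket_def)
    then show ?thesis by (intro exI[of _ 0] conjI exI[of _ l]) simp_all
  qed
  have nz': "\<exists>i<2. \<exists>p<4. flipped_ket l i p \<noteq> 0" if "l < 5" for l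
  proof -
    from nz[OF that] obtain i p where "i < 2" "p < 4" "edge_ket l i p \<noteq> 0" by blast
    then show ?thesis by (intro exI[of _ i] conjI exI[of _ "3 - p"]) (auto simp: flipped_ket_def)
  qed
  show "schmidt_number_map d (kraus_map d 5 edge_ket) = 2"
  proof (rule schmidt_number_kraus_map_eq_2[OF d2])
    show "edge_ket l i p = 0" if "2 \<le> i" for l i p using ket_support(1)[of l i p] that by force
    show "\<exists>i<d. \<exists>p<d. edge_ket l i p \<noteq> 0" if "l < 5" for l
      using nz[OF that] d by (meson d2 less_le_trans)
    fix M :: nat and s t :: "nat \<Rightarrow> nat \<Rightarrow> complex"
    assume "\<And>i j p q. i < 2 \<Longrightarrow> j < 2 \<Longrightarrow> p < d \<Longrightarrow> q < d \<Longrightarrow>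
        (\<Sum>l<5. edge_ket l i p * cnj (edge_ket l j q)) = (\<Sum>k<M. s k i * cnj (s k j) * (t k p * cnj (t k q)))"
    then show False
      by (intro edge_state_entangled[OF d, of "{..<M}" "\<lambda>k. mat d d (\<lambda>(p, q). t k p * cnj (t k q))" s])
        (auto simp: product_mat_psd)
  qed
  show "schmidt_number_map d (kraus_map d 5 flipped_ket) = 2"
  proof (rule schmidt_number_kraus_map_eq_2[OF d2])
    show "flipped_ket l i p = 0" if "2 \<le> i" for l i p using ket_support(2)[of l i p] that by force
    show "\<exists>i<d. \<exists>p<d. flipped_ket l i p \<noteq> 0" if "l < 5" for l
      using nz'[OF that] d by (meson d2 less_le_trans)
    fix M :: nat and s t :: "nat \<Rightarrow> nat \<Rightarrow> complex"
    assume "\<And>i j p q. i < 2 \<Longrightarrow> j < 2 \<Longrightarrow> p < d \<Longrightarrow> q < d \<Longrightarrow>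
        (\<Sum>l<5. flipped_ket l i p * cnj (flipped_ket l j q)) = (\<Sum>k<M. s k i * cnj (s k j) * (t k p * cnj (t k q)))"
    then show False
      by (intro flipped_state_entangled[OF d, of "{..<M}" "\<lambda>k. mat d d (\<lambda>(p, q). t k p * cnj (t k q))" s])
        (auto simp: product_mat_psd)
  qed
qed

text \<open>
  The first factor has size two, so its Gram vectors split a separable matrix into terms of the
  form that the range criterion handles.
\<close>

lemma separable_mat_gram:
  assumes "separable_mat 2 n Y"
  obtains K :: "(nat \<times> nat) set" and e B where "finite K" "\<forall>k\<in>K. B k \<in> psd n"
    "\<forall>i<2. \<forall>j<2. \<forall>p<n. \<forall>q<n.
      Y $$ (i * n + p, j * n + q) = (\<Sum>k\<in>K. e k i * cnj (e k j) * B k $$ (p, q))"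
proof -
  obtain N :: nat and A B where AB: "\<And>k. k < N \<Longrightarrow> A k \<in> psd 2" "\<And>k. k < N \<Longrightarrow> B k \<in> psd n"
    and Y: "Y = finsum (module_mat TYPE(complex) (2 * n) (2 * n)) (\<lambda>k. kron (A k) (B k)) {..<N}"
    using assms unfolding separable_mat_def by blast
  have "\<exists>e :: nat \<Rightarrow> nat \<Rightarrow> complex. \<forall>i<2. \<forall>j<2. A k $$ (i, j) = (\<Sum>l<2. e l i * cnj (e l j))" if "k < N" for k
    using psd_2_gram[OF AB(1)[OF that]] by metis
  then obtain e :: "nat \<Rightarrow> nat \<Rightarrow> nat \<Rightarrow> complex" where e: "\<And>k i j. k < N \<Longrightarrow> i < 2 \<Longrightarrow> j < 2 \<Longrightarrow>
      A k $$ (i, j) = (\<Sum>l<2. e k l i * cnj (e k l j))"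
    by metis
  have c: "A k \<in> carrier_mat 2 2" "B k \<in> carrier_mat n n" if "k < N" for k
    using AB[OF that] by (auto simp: psd_def)
  show ?thesis
  proof (rule that[of "{..<N} \<times> {..<2}" "\<lambda>(k, l). B k" "\<lambda>(k, l). e k l"]; (intro allI impI)?)
    fix i j p q assume lt: "i < (2::nat)" "j < (2::nat)" "p < n" "q < n"
    have "Y $$ (i * n + p, j * n + q) = (\<Sum>k<N. kron (A k) (B k) $$ (i * n + p, j * n + q))"
      unfolding Y by (rule finsum_mat_index) (use lt c in \<open>auto intro: kron_carrier tensor_index_less\<close>)
    also have "\<dots> = (\<Sum>k<N. \<Sum>l<2. e k l i * cnj (e k l j) * B k $$ (p, q))"
    proof (intro sum.cong refl)
      fix k assume "k \<in> {..<N}"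
      then have k: "k < N" by simp
      have "kron (A k) (B k) $$ (i * n + p, j * n + q) = A k $$ (i, j) * B k $$ (p, q)"
        using c[OF k] lt tensor_index_less[of i 2 p n] tensor_index_less[of j 2 q n] by (auto simp: kron_def)
      also have "\<dots> = (\<Sum>l<2. e k l i * cnj (e k l j) * B k $$ (p, q))"
        unfolding e[OF k lt(1,2)] by (rule sum_distrib_right)
      finally show "kron (A k) (B k) $$ (i * n + p, j * n + q) = (\<Sum>l<2. e k l i * cnj (e k l j) * B k $$ (p, q))" .
    qed
    finally show "Y $$ (i * n + p, j * n + q) = (\<Sum>x\<in>{..<N} \<times> {..<2}. (case x of (k, l) \<Rightarrow> e k l) i
        * cnj ((case x of (k, l) \<Rightarrow> e k l) j) * (case x of (k, l) \<Rightarrow> B k) $$ (p, q))"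
      by (simp add: sum.cartesian_product split_def)
  qed (use AB in auto)
qed

text \<open>
  Applied to the projection onto \<open>\<eta> = |00\<rangle> + |11\<rangle>\<close>, whose blocks are the matrix units, \<open>id\<^sub>2 \<otimes> \<Phi>\<close> returns
  the entangled state.
\<close>

lemma edge_map_not_2_entanglement_breaking:
  assumes d: "4 \<le> d"
  shows "\<not> k_entanglement_breaking 2 d (kraus_map d 5 edge_ket)"
proof
  let ?\<Phi> = "kraus_map d 5 edge_ket"
  define \<eta> :: "complex vec" where "\<eta> = vec (2 * d) (\<lambda>x. if x div d = x mod d then 1 else 0)"
  assume "k_entanglement_breaking 2 d ?\<Phi>"
  moreover have "ketbra \<eta> \<in> psd (2 * d)" using ketbra_psd[of \<eta>] by (simp add: \<eta>_def)
  ultimately have "separable_mat 2 d (ampliation 2 d ?\<Phi> (ketbra \<eta>))"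
    by (simp add: k_entanglement_breaking_def)
  then obtain K :: "(nat \<times> nat) set" and e B where K: "finite K" "\<forall>k\<in>K. B k \<in> psd d"
    and sep: "\<forall>i<2. \<forall>j<2. \<forall>p<d. \<forall>q<d.
      ampliation 2 d ?\<Phi> (ketbra \<eta>) $$ (i * d + p, j * d + q) = (\<Sum>k\<in>K. e k i * cnj (e k j) * B k $$ (p, q))"
    by (rule separable_mat_gram)
  have block: "mat_block d (ketbra \<eta>) i j = mat_unit d i j" if "i < 2" "j < 2" for i j
    using that tensor_index_less[of _ 2 _ d]
    by (intro eq_matI) (auto simp: mat_block_def mat_unit_def ketbra_def \<eta>_def)
  show False
  proof (rule edge_state_entangled[OF d K(1)])
    show "B k \<in> psd d" if "k \<in> K" for k using K(2) that by blast
  next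
    fix i j p q assume lt: "i < (2::nat)" "j < (2::nat)" "p < d" "q < d"
    show "(\<Sum>l<5. edge_ket l i p * cnj (edge_ket l j q)) = (\<Sum>k\<in>K. e k i * cnj (e k j) * B k $$ (p, q))"
      using sep[rule_format, OF lt] lt d by (simp add: ampliation_index block kraus_map_mat_unit)
  qed
qed

text \<open>
  Transposing the output of \<open>\<Phi>\<close> is a partial transpose of the Choi matrix in the second factor. As the
  state is real and symmetric, this agrees with the partial transpose in the first factor, which the
  flipped vectors realise.
\<close>

lemma transpose_edge_map: "transpose_mat \<circ> kraus_map d 5 edge_ket = kraus_map d 5 flipped_ket"
proof (rule ext, rule eq_matI)
  fix A p q assume "p < dim_row (kraus_map d 5 flipped_ket A)" "q < dim_col (kraus_map d 5 flipped_ket A)"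
  then have pq: "p < d" "q < d" by (simp_all add: kraus_map_def)
  have entry: "kraus_map d 5 w A $$ (p, q) = (\<Sum>i<d. \<Sum>j<d. (\<Sum>l<5. w l i p * cnj (w l j q)) * A $$ (i, j))"
    if "p < d" "q < d" for w p q
  proof -
    have "kraus_map d 5 w A $$ (p, q) = (\<Sum>l<5. \<Sum>i<d. \<Sum>j<d. w l i p * cnj (w l j q) * A $$ (i, j))"
      using that by (simp add: kraus_map_def ac_simps)
    also have "\<dots> = (\<Sum>i<d. \<Sum>j<d. \<Sum>l<5. w l i p * cnj (w l j q) * A $$ (i, j))"
      by (simp only: sum.swap[of _ _ "{..<5}"])
    finally show ?thesis by (simp only: sum_distrib_right)
  qed
  have "kraus_map d 5 edge_ket A $$ (q, p) = kraus_map d 5 flipped_ket A $$ (p, q)"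
    unfolding entry[OF pq] entry[OF pq(2,1)] flipped_ket_partial_transpose
    by (simp add: cnj_ket mult.commute)
  then show "(transpose_mat \<circ> kraus_map d 5 edge_ket) A $$ (p, q) = kraus_map d 5 flipped_ket A $$ (p, q)"
    using pq by (simp add: kraus_map_def)
qed (simp_all add: kraus_map_def)

lemma choi_edge_map_transpose:
  "choi_matrix d (kraus_map d 5 edge_ket \<circ> transpose_mat) = choi_matrix d (kraus_map d 5 flipped_ket)"
proof (rule tensor_mat_eqI)
  show "choi_matrix d (kraus_map d 5 edge_ket \<circ> transpose_mat) \<in> carrier_mat (d * d) (d * d)"
    by (rule choi_matrix_carrier) simp
  show "choi_matrix d (kraus_map d 5 flipped_ket) \<in> carrier_mat (d * d) (d * d)"
    by (rule choi_kraus_map)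
  fix i p j q assume lt: "i < d" "p < d" "j < d" "q < d"
  have "transpose_mat (mat_unit d i j) = mat_unit d j i"
    by (rule eq_matI) (auto simp: mat_unit_def)
  then show "choi_matrix d (kraus_map d 5 edge_ket \<circ> transpose_mat) $$ (i * d + p, j * d + q)
      = choi_matrix d (kraus_map d 5 flipped_ket) $$ (i * d + p, j * d + q)"
    using lt by (simp add: choi_matrix_index kraus_map_mat_unit flipped_ket_partial_transpose)
qed

theorem proposition3p15:
  fixes d :: nat
  assumes "d \<ge> 4"
  shows "\<exists>\<Phi> :: complex mat \<Rightarrow> complex mat.
           PPT_map d \<Phi> \<and> \<not> k_entanglement_breaking 2 d \<Phi> \<and>
           schmidt_number_map d \<Phi> = 2 \<and> schmidt_number_map d (\<Phi> \<circ> transpose_mat) = 2"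
proof (intro exI conjI)
  show "PPT_map d (kraus_map d 5 edge_ket)"
    by (simp add: PPT_map_def transpose_edge_map kraus_map_completely_positive)
  show "\<not> k_entanglement_breaking 2 d (kraus_map d 5 edge_ket)"
    using assms by (rule edge_map_not_2_entanglement_breaking)
  show "schmidt_number_map d (kraus_map d 5 edge_ket) = 2"
    using assms by (rule schmidt_number_edge_map)
  show "schmidt_number_map d (kraus_map d 5 edge_ket \<circ> transpose_mat) = 2"
    using schmidt_number_edge_map(2)[OF assms]
    by (simp add: schmidt_number_map_def choi_edge_map_transpose)
qed

end
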